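(* Let $G$ be a group with identity $e$ and let $A\subseteq G$. The following statements are equivalent: (i) $A$ is scattered; (ii) $A$ is disparse; (iii) $A$ contains no subset that is coarsely equivalent to the group $\bigoplus_{\omega}\mathbb{Z}_2$; (iv) $A$ contains no piecewise shifted $IP$-set.
   Context: Ultrafilters. $G$ is regarded as a discrete space and $\beta G$ is its Stone–Čech compactification, whose points are the ultrafilters on $G$; a base of the topology consists of the sets $\overline{A}=\{p\in\beta G: A\in p\}$, $A\subseteq G$. Points of $G$ are identified with principal ultrafilters, $G^*=\beta G\setminus G$ is the set of free ultrafilters, and $A^*=\overline{A}\cap G^*$. For $g\in G$ and $p\in\beta G$, $gp=\{gP: P\in p\}$, and $Gp=\{gp: g\in G\}$. For $A\subseteq G$ and $p\in G^*$ put $\Delta_p(A)=A^*\cap Gp=\{gp: g\in G,\ A\in gp\}$. The sets $\Delta_p(A)$, $p\in G^*$, are called the ultracompanions of $A$. Scattered and disparse. $A$ is disparse if each ultracompanion $\Delta_p(A)$, $p\in G^*$, is discrete (as a subspace of $\beta G$). $A$ is scattered if for each infinite subset $Y$ of $A$ there is $p\in Y^*$ such that $\Delta_p(Y)$ is finite. Coarse equivalence. For any group $G$, $[G]^{<\omega}$ is the family of all finite subsets of $G$. For $F\in[G]^{<\omega}$ and $g\in G$, $B(g,F)=Fg\cup\{g\}$, and for $Y\subseteq G$, $B_Y(g,F)=Y\cap B(g,F)$; for $Y'\subseteq Y$, $B_Y(Y',F)=\bigcup_{y\in Y'}B_Y(y,F)$. Let $G,H$ be groups, $X\subseteq G$,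 $Y\subseteq H$. A mapping $f:X\to Y$ is a $\prec$-mapping if for every $F\in[G]^{<\omega}$ there is $K\in[H]^{<\omega}$ such that $f(B_X(x,F))\subseteq B_Y(f(x),K)$ for every $x\in X$. If $f$ is a bijection such that both $f$ and $f^{-1}$ are $\prec$-mappings, then $f$ is an asymorphism and $X,Y$ are called asymorphic. $X$ and $Y$ are coarsely equivalent if there exist asymorphic subsets $X'\subseteq X$ and $Y'\subseteq Y$ such that $X\subseteq B_X(X',F)$ and $Y\subseteq B_Y(Y',K)$ for some $F\in[G]^{<\omega}$ and $K\in[H]^{<\omega}$. $\bigoplus_\omega\mathbb{Z}_2$ is the direct sum of countably many copies of the group of order 2. Piecewise shifted $IP$-sets. Given an injective sequence $(g_n)_{n<\omega}$ in $G$ and an arbitrary sequence $(b_n)_{n<\omega}$ in $G$, the set of all elements $g_{i_1}g_{i_2}\cdots g_{i_n}b_{i_n}$, where $n\geq 1$ and $0\le i_1<i_2<\dots<i_n<\omega$, is called a piecewise shifted $IP$-set. *)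

theory Defs
  imports "HOL-Analysis.Analysis" "HOL-Algebra.Product_Groups"
begin

section \<open>Ultrafilters and the Stone-Cech compactification of a discrete space\<close>

definition ultrafilter_on :: "'a set \<Rightarrow> 'a set set \<Rightarrow> bool" where
  "ultrafilter_on X p \<longleftrightarrow>
     p \<subseteq> Pow X \<and> X \<in> p \<and> {} \<notin> p \<and>
     (\<forall>A\<in>p. \<forall>B\<in>p. A \<inter> B \<in> p) \<and>
     (\<forall>A\<in>p. \<forall>B. A \<subseteq> B \<and> B \<subseteq> X \<longrightarrow> B \<in> p) \<and>
     (\<forall>A. A \<subseteq> X \<longrightarrow> A \<in> p \<or> X - A \<in> p)"

definition principal_ultrafilter :: "'a set \<Rightarrow> 'a \<Rightarrow> 'a set set" where
  "principal_ultrafilter X x = {A. A \<subseteq> X \<and> x \<in> A}"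

definition stone_basic :: "'a set \<Rightarrow> 'a set \<Rightarrow> 'a set set set" where
  "stone_basic X A = {p. ultrafilter_on X p \<and> A \<in> p}"

definition stone_cech :: "'a set \<Rightarrow> 'a set set topology" where
  "stone_cech X = topology_generated_by {stone_basic X A | A. A \<subseteq> X}"

text \<open>The set written \<open>A\<^sup>*\<close> in the literature; \<open>free_part X X\<close> is the remainder \<open>X\<^sup>*\<close>.\<close>

definition free_part :: "'a set \<Rightarrow> 'a set \<Rightarrow> 'a set set set" where
  "free_part X A = stone_basic X A - principal_ultrafilter X ` X"

lemma stone_basic_Int:
  assumes "A \<subseteq> X" "B \<subseteq> X"
  shows "stone_basic X A \<inter> stone_basic X B = stone_basic X (A \<inter> B)"
proof -
  have "A \<in> p \<and> B \<in> p \<longleftrightarrow> A \<inter> B \<in> p" if "ultrafilter_on X p" for p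
  proof
    have up: "C \<in> p \<Longrightarrow> C \<subseteq> D \<Longrightarrow> D \<subseteq> X \<Longrightarrow> D \<in> p" for C D
      using that unfolding ultrafilter_on_def by simp
    show "A \<inter> B \<in> p" if "A \<in> p \<and> B \<in> p"
      using that \<open>ultrafilter_on X p\<close> unfolding ultrafilter_on_def by simp
    show "A \<in> p \<and> B \<in> p" if "A \<inter> B \<in> p"
      using up[OF that] assms by simp
  qed
  then show ?thesis
    unfolding stone_basic_def by blast
qed

lemma topspace_stone_cech: "topspace (stone_cech X) = Collect (ultrafilter_on X)"
proof -
  have "X \<in> p" if "ultrafilter_on X p" for p
    using that by (simp add: ultrafilter_on_def)
  then have "stone_basic X X = Collect (ultrafilter_on X)"
    by (auto simp: stone_basic_def)
  moreover have "stone_basic X A \<subseteq> Collect (ultrafilter_on X)" for A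
    by (auto simp: stone_basic_def)
  ultimately show ?thesis
    unfolding stone_cech_def topology_generated_by_topspace by blast
qed


section \<open>Ultracompanions, scattered and disparse subsets\<close>

definition translate_ultrafilter ::
  "('a, 'b) monoid_scheme \<Rightarrow> 'a \<Rightarrow> 'a set set \<Rightarrow> 'a set set" where
  "translate_ultrafilter G g p = {g <#\<^bsub>G\<^esub> P | P. P \<in> p}"

definition ultrafilter_orbit ::
  "('a, 'b) monoid_scheme \<Rightarrow> 'a set set \<Rightarrow> 'a set set set" where
  "ultrafilter_orbit G p = {translate_ultrafilter G g p | g. g \<in> carrier G}"

definition ultracompanion ::
  "('a, 'b) monoid_scheme \<Rightarrow> 'a set set \<Rightarrow> 'a set \<Rightarrow> 'a set set set" where
  "ultracompanion G p A = free_part (carrier G) A \<inter> ultrafilter_orbit G p"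

definition scattered :: "('a, 'b) monoid_scheme \<Rightarrow> 'a set \<Rightarrow> bool" where
  "scattered G A \<longleftrightarrow>
     (\<forall>Y. Y \<subseteq> A \<and> infinite Y \<longrightarrow>
        (\<exists>p \<in> free_part (carrier G) Y. finite (ultracompanion G p Y)))"

definition disparse :: "('a, 'b) monoid_scheme \<Rightarrow> 'a set \<Rightarrow> bool" where
  "disparse G A \<longleftrightarrow>
     (\<forall>p \<in> free_part (carrier G) (carrier G).
        subtopology (stone_cech (carrier G)) (ultracompanion G p A)
          = discrete_topology (ultracompanion G p A))"


section \<open>Coarse equivalence\<close>

definition coarse_ball :: "('a, 'b) monoid_scheme \<Rightarrow> 'a set \<Rightarrow> 'a \<Rightarrow> 'a set \<Rightarrow> 'a set" where
  "coarse_ball G Y g F = Y \<inter> ((F #>\<^bsub>G\<^esub> g) \<union> {g})"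

definition coarse_nbhd :: "('a, 'b) monoid_scheme \<Rightarrow> 'a set \<Rightarrow> 'a set \<Rightarrow> 'a set \<Rightarrow> 'a set" where
  "coarse_nbhd G Y Y' F = (\<Union>y\<in>Y'. coarse_ball G Y y F)"

definition prec_mapping ::
  "('a, 'c) monoid_scheme \<Rightarrow> 'a set \<Rightarrow> ('b, 'd) monoid_scheme \<Rightarrow> 'b set \<Rightarrow> ('a \<Rightarrow> 'b) \<Rightarrow> bool" where
  "prec_mapping G X H Y f \<longleftrightarrow>
     f \<in> X \<rightarrow> Y \<and>
     (\<forall>F. finite F \<and> F \<subseteq> carrier G \<longrightarrow>
        (\<exists>K. finite K \<and> K \<subseteq> carrier H \<and>
           (\<forall>x\<in>X. f ` coarse_ball G X x F \<subseteq> coarse_ball H Y (f x) K)))"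

definition asymorphism ::
  "('a, 'c) monoid_scheme \<Rightarrow> 'a set \<Rightarrow> ('b, 'd) monoid_scheme \<Rightarrow> 'b set \<Rightarrow> ('a \<Rightarrow> 'b) \<Rightarrow> bool" where
  "asymorphism G X H Y f \<longleftrightarrow>
     bij_betw f X Y \<and> prec_mapping G X H Y f \<and> prec_mapping H Y G X (inv_into X f)"

definition asymorphic ::
  "('a, 'c) monoid_scheme \<Rightarrow> 'a set \<Rightarrow> ('b, 'd) monoid_scheme \<Rightarrow> 'b set \<Rightarrow> bool" where
  "asymorphic G X H Y \<longleftrightarrow> (\<exists>f. asymorphism G X H Y f)"

definition coarsely_equivalent ::
  "('a, 'c) monoid_scheme \<Rightarrow> 'a set \<Rightarrow> ('b, 'd) monoid_scheme \<Rightarrow> 'b set \<Rightarrow> bool" where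
  "coarsely_equivalent G X H Y \<longleftrightarrow>
     (\<exists>X' Y'. X' \<subseteq> X \<and> Y' \<subseteq> Y \<and> asymorphic G X' H Y' \<and>
        (\<exists>F. finite F \<and> F \<subseteq> carrier G \<and> X \<subseteq> coarse_nbhd G X X' F) \<and>
        (\<exists>K. finite K \<and> K \<subseteq> carrier H \<and> Y \<subseteq> coarse_nbhd H Y Y' K))"

definition Z2_sum :: "(nat \<Rightarrow> int) monoid" where
  "Z2_sum = sum_group UNIV (\<lambda>_. integer_mod_group 2)"

lemma group_Z2_sum: "group Z2_sum"
  by (simp add: Z2_sum_def)


section \<open>Piecewise shifted IP-sets\<close>

text \<open>
  A nonempty finite set of indices is given by its strictly increasing list \<open>[i\<^sub>1, \<dots>, i\<^sub>n]\<close>;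
  the fold is \<open>g i\<^sub>1 \<otimes> (g i\<^sub>2 \<otimes> \<dots> (g i\<^sub>n \<otimes> b i\<^sub>n))\<close>.
\<close>

definition piecewise_shifted_IP_set ::
  "('a, 'b) monoid_scheme \<Rightarrow> (nat \<Rightarrow> 'a) \<Rightarrow> (nat \<Rightarrow> 'a) \<Rightarrow> 'a set" where
  "piecewise_shifted_IP_set G g b =
     {foldr (\<lambda>i x. g i \<otimes>\<^bsub>G\<^esub> x) js (b (last js)) | js. js \<noteq> [] \<and> sorted_wrt (<) js}"

definition is_piecewise_shifted_IP_set :: "('a, 'b) monoid_scheme \<Rightarrow> 'a set \<Rightarrow> bool" where
  "is_piecewise_shifted_IP_set G S \<longleftrightarrow>
     (\<exists>g b. g \<in> UNIV \<rightarrow> carrier G \<and> inj g \<and> b \<in> UNIV \<rightarrow> carrier G \<and>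
        S = piecewise_shifted_IP_set G g b)"

end

theory Submission
  imports Defs
begin

text \<open>
  The four negations follow from one another in a cycle: a piecewise shifted IP-set contains a
  coarse copy of \<open>\<Oplus>\<^sub>\<omega> \<int>\<^sub>2\<close>, a set with such a copy is not scattered, a set that is not
  scattered is not disparse, and a set that is not disparse contains a piecewise shifted IP-set.
  Throughout, \<open>G\<close> acts freely on its ultrafilters (\<open>translate_fixed_imp_one\<close>), so counting the
  members of an ultracompanion \<open>\<Delta>\<^sub>p(A)\<close> amounts to counting the \<open>g\<close> with \<open>A \<in> g p\<close>, and \<open>p \<in> A\<^sup>*\<close>
  is isolated in \<open>\<Delta>\<^sub>p(A)\<close> when some \<open>U \<in> p\<close> lies in \<open>g p\<close> for \<open>g = \<one>\<close> only.

  \<^item> From an IP-set to a coarse copy (\<open>IP_imp_coarse_copy\<close>). A nonzero vector with support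
    \<open>i\<^sub>1 < \<dots> < i\<^sub>n\<close> is sent to \<open>g i\<^sub>1 \<cdots> g i\<^sub>n b i\<^sub>n\<close>. If two supports agree above \<open>m\<close> and differ at
    \<open>m\<close>, the common tail cancels in the quotient of the two images, unless one support ends
    before \<open>m\<close>; either way the quotient is one of finitely many elements attached to \<open>m\<close>. Hence the
    map is a \<open>\<prec>\<close>-mapping. After passing to a sparse subsequence, with each \<open>b i\<close> replaced
    by some \<open>g k b k\<close> for a later index \<open>k\<close>, elements attached to different levels \<open>m\<close> are different
    and none of them is \<open>\<one>\<close>; hence the map is injective and its inverse is a \<open>\<prec>\<close>-mapping too.

  \<^item> From a coarse copy to a set that is not scattered (\<open>coarse_copy_imp_not_scattered\<close>). Let \<open>X\<close>
    be asymorphic to a large subset \<open>Y\<close> of an infinite group \<open>H\<close>, and let \<open>q \<in> X\<^sup>*\<close>. Infinitely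
    many shifts by elements of \<open>H\<close> keep \<open>q\<close>-almost all of \<open>Y\<close> inside \<open>Y\<close>. On a member of \<open>q\<close>, each
    of them agrees with left multiplication by an element of \<open>G\<close>, because only finitely many
    elements of \<open>G\<close> are possible. Different shifts give different elements, so \<open>\<Delta>\<^sub>q(X)\<close> is infinite.

  \<^item> Disparse sets are scattered (\<open>disparse_imp_scattered\<close>). Among the traces on \<open>Y\<^sup>*\<close> of orbit
    closures of points of \<open>Y\<^sup>*\<close>, choose a minimal one, \<open>Z\<close>. By minimality, the orbit of every point
    of \<open>Z\<close> is dense in \<open>Z\<close>. A point that is isolated in its ultracompanion is therefore isolated in
    \<open>Z\<close>; if this holds at all points, the compact set \<open>Z\<close> is finite, and it contains an
    ultracompanion of \<open>Y\<close>.

  \<^item> From a point \<open>q \<in> A\<^sup>*\<close> that is not isolated in its ultracompanion to an IP-set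
    (\<open>not_disparse_imp_IP\<close>). Every \<open>P \<in> q\<close> satisfies \<open>g\<^sup>-\<^sup>1 P \<in> q\<close> for some \<open>g \<noteq> \<one>\<close>. Starting with
    \<open>P\<^sub>0 = A\<close>, choose \<open>g n\<close> for \<open>P\<^sub>n\<close>, then a member \<open>P\<^bsub>n+1\<^esub>\<close> of \<open>q\<close> inside
    \<open>P\<^sub>n \<inter> (g n)\<^sup>-\<^sup>1 P\<^sub>n\<close> and a point \<open>b n \<in> P\<^bsub>n+1\<^esub>\<close>, as in
    the usual proof of Hindman's theorem from an idempotent ultrafilter.
\<close>

section \<open>Ultrafilters on a set\<close>

lemma ultrafilter_superset:
  assumes "ultrafilter_on X p" "P \<in> p" "P \<subseteq> Q" "Q \<subseteq> X"
  shows "Q \<in> p"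
proof -
  have "\<forall>P\<in>p. \<forall>Q. P \<subseteq> Q \<and> Q \<subseteq> X \<longrightarrow> Q \<in> p"
    using assms(1) unfolding ultrafilter_on_def by (elim conjE)
  from this[rule_format, OF assms(2)] show ?thesis using assms(3,4) by blast
qed

lemma ultrafilter_subset_carrier:
  "ultrafilter_on X p \<Longrightarrow> P \<in> p \<Longrightarrow> P \<subseteq> X"
  by (auto simp: ultrafilter_on_def)

lemma ultrafilter_space: "ultrafilter_on X p \<Longrightarrow> X \<in> p"
  unfolding ultrafilter_on_def by blast

lemma ultrafilter_Int:
  "ultrafilter_on X p \<Longrightarrow> P \<in> p \<Longrightarrow> Q \<in> p \<Longrightarrow> P \<inter> Q \<in> p"
  unfolding ultrafilter_on_def by blast

lemma ultrafilter_nonempty: "ultrafilter_on X p \<Longrightarrow> P \<in> p \<Longrightarrow> P \<noteq> {}"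
  unfolding ultrafilter_on_def by blast

lemma ultrafilter_Diff_iff:
  assumes "ultrafilter_on X p" "P \<subseteq> X"
  shows "X - P \<in> p \<longleftrightarrow> P \<notin> p"
proof -
  have "P \<in> p \<or> X - P \<in> p"
    using assms unfolding ultrafilter_on_def by blast
  moreover have "\<not> (P \<in> p \<and> X - P \<in> p)"
    using ultrafilter_Int[OF assms(1)] ultrafilter_nonempty[OF assms(1)]
    by (metis Diff_disjoint)
  ultimately show ?thesis by blast
qed

lemma ultrafilter_finite_Union:
  assumes p: "ultrafilter_on X p" and "finite I"
    and "(\<Union>i\<in>I. B i) \<in> p"
  shows "\<exists>i\<in>I. B i \<in> p"
  using assms(2,3)
proof (induction I)
  case empty
  then show ?case using ultrafilter_nonempty[OF p] by auto
next
  case (insert i I)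
  have sub: "B i \<subseteq> X" "(\<Union>j\<in>I. B j) \<subseteq> X"
    using ultrafilter_subset_carrier[OF p insert.prems] by auto
  show ?case
  proof (cases "B i \<in> p")
    case False
    then have "X - B i \<in> p" using ultrafilter_Diff_iff[OF p] sub by blast
    from ultrafilter_Int[OF p insert.prems this] have "(\<Union>j\<in>I. B j) \<in> p"
      by (rule ultrafilter_superset[OF p]) (use sub in auto)
    then show ?thesis using insert.IH by blast
  qed blast
qed

lemma ultrafilter_finite_Inter:
  assumes "ultrafilter_on X p" "finite C" "C \<subseteq> p"
  shows "X \<inter> \<Inter>C \<in> p"
  using assms(2,3)
proof (induction C)
  case empty
  then show ?case using ultrafilter_space[OF assms(1)] by simp
next
  case (insert P C)
  then have "P \<inter> (X \<inter> \<Inter>C) \<in> p"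
    using ultrafilter_Int[OF assms(1)] by blast
  moreover have "P \<inter> (X \<inter> \<Inter>C) = X \<inter> \<Inter>(insert P C)" by auto
  ultimately show ?case by simp
qed

lemma ultrafilter_subset_imp_eq:
  assumes "ultrafilter_on X p" "ultrafilter_on X q" "p \<subseteq> q"
  shows "p = q"
proof (rule ccontr)
  assume "p \<noteq> q"
  then obtain P where "P \<in> q" "P \<notin> p" using assms(3) by blast
  then show False
    using ultrafilter_Diff_iff assms ultrafilter_subset_carrier by (metis subsetD)
qed

text \<open>Compactness of the space of ultrafilters. By Zorn's lemma there is a maximal extension with
  the finite intersection property; maximality puts a set or its complement into it.\<close>

lemma ultrafilter_extending:
  assumes "E \<subseteq> Pow X" and fip: "\<And>C. finite C \<Longrightarrow> C \<subseteq> E \<Longrightarrow> X \<inter> \<Inter>C \<noteq> {}"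
  obtains p where "ultrafilter_on X p" "E \<subseteq> p"
proof -
  define centred where "centred M \<longleftrightarrow> (\<forall>C. finite C \<longrightarrow> C \<subseteq> M \<longrightarrow> X \<inter> \<Inter>C \<noteq> {})" for M
  have centredI: "centred M" if "\<And>C. finite C \<Longrightarrow> C \<subseteq> M \<Longrightarrow> X \<inter> \<Inter>C \<noteq> {}" for M
    using that by (simp add: centred_def)
  have centredD: "X \<inter> \<Inter>C \<noteq> {}" if "centred M" "finite C" "C \<subseteq> M" for M C
    using that by (simp add: centred_def)
  define \<A> where "\<A> = {M. E \<subseteq> M \<and> M \<subseteq> Pow X \<and> centred M}"
  have "centred E" using fip by (rule centredI)
  then have "E \<in> \<A>" using assms(1) by (simp add: \<A>_def)
  have "\<exists>M\<in>\<A>. \<forall>N\<in>\<A>. M \<subseteq> N \<longrightarrow> N = M"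
  proof (rule subset_Zorn_nonempty)
    show "\<A> \<noteq> {}" using \<open>E \<in> \<A>\<close> by blast
    fix \<C> assume ne: "\<C> \<noteq> {}" and ch: "subset.chain \<A> \<C>"
    then have sub: "\<C> \<subseteq> \<A>" unfolding subset_chain_def by blast
    have "centred (\<Union>\<C>)"
    proof (rule centredI)
      fix C assume C: "finite C" "C \<subseteq> \<Union>\<C>"
      obtain B where "B \<in> \<C>" "C \<subseteq> B"
        using finite_subset_Union_chain[OF C ne ch] by blast
      moreover have "centred B" using sub \<open>B \<in> \<C>\<close> \<A>_def by auto
      ultimately show "X \<inter> \<Inter>C \<noteq> {}" using centredD C(1) by simp
    qed
    moreover have "E \<subseteq> \<Union>\<C>" "\<Union>\<C> \<subseteq> Pow X" using sub ne \<A>_def by fast+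
    ultimately show "\<Union>\<C> \<in> \<A>" by (simp add: \<A>_def)
  qed
  then obtain M where M: "M \<in> \<A>" and max: "\<And>N. N \<in> \<A> \<Longrightarrow> M \<subseteq> N \<Longrightarrow> N = M" by blast
  then have MX: "M \<subseteq> Pow X" and EM: "E \<subseteq> M" and "centred M"
    by (simp_all add: \<A>_def)
  note MC = centredD[OF \<open>centred M\<close>]
  have memI: "B \<in> M" if B: "B \<subseteq> X" and C: "\<And>C. finite C \<Longrightarrow> C \<subseteq> M \<Longrightarrow> B \<inter> \<Inter>C \<noteq> {}" for B
  proof -
    have "centred (insert B M)"
    proof (rule centredI)
      fix C assume C': "finite C" "C \<subseteq> insert B M"
      then have "B \<inter> \<Inter>(C - {B}) \<noteq> {}" by (intro C) auto
      then show "X \<inter> \<Inter>C \<noteq> {}" using B by auto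
    qed
    then have "insert B M \<in> \<A>" using EM MX B by (auto simp: \<A>_def)
    then show ?thesis using max by blast
  qed
  have "ultrafilter_on X M"
    unfolding ultrafilter_on_def
  proof (intro conjI ballI allI impI)
    show "X \<in> M" by (rule memI) (use MC in auto)
    show "{} \<notin> M" using MC[of "{{}}"] by auto
    show "P \<inter> Q \<in> M" if "P \<in> M" "Q \<in> M" for P Q
    proof (rule memI)
      fix C assume "finite C" "C \<subseteq> M"
      then show "P \<inter> Q \<inter> \<Inter>C \<noteq> {}" using MC[of "insert P (insert Q C)"] that by auto
    qed (use that MX in auto)
    show "Q \<in> M" if "P \<in> M" "P \<subseteq> Q \<and> Q \<subseteq> X" for P Q
    proof (rule memI)
      fix C assume "finite C" "C \<subseteq> M"
      then show "Q \<inter> \<Inter>C \<noteq> {}" using MC[of "insert P C"] that by auto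
    qed (use that in auto)
    show "P \<in> M \<or> X - P \<in> M" if P: "P \<subseteq> X" for P
    proof (rule ccontr)
      assume "\<not> (P \<in> M \<or> X - P \<in> M)"
      then obtain C D where "finite C" "C \<subseteq> M" "P \<inter> \<Inter>C = {}"
        "finite D" "D \<subseteq> M" "(X - P) \<inter> \<Inter>D = {}"
        using memI[OF P] memI[of "X - P"] by (metis Diff_subset)
      moreover from this have "X \<inter> \<Inter>(C \<union> D) \<noteq> {}" by (intro MC) auto
      ultimately show False by blast
    qed
  qed (use MX in auto)
  then show thesis using that EM by blast
qed

lemma free_part_iff:
  "p \<in> free_part X B \<longleftrightarrow> ultrafilter_on X p \<and> B \<in> p \<and> (\<forall>x\<in>X. {x} \<notin> p)"
proof -
  have "p = principal_ultrafilter X x \<longleftrightarrow> {x} \<in> p" if p: "ultrafilter_on X p" and x: "x \<in> X" for x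
  proof
    assume "{x} \<in> p"
    then have "x \<in> P" if "P \<in> p" for P
      using ultrafilter_Int[OF p that] ultrafilter_nonempty[OF p] by fastforce
    then show "p = principal_ultrafilter X x"
      using \<open>{x} \<in> p\<close> ultrafilter_subset_carrier[OF p] ultrafilter_superset[OF p]
      unfolding principal_ultrafilter_def by blast
  qed (use x in \<open>auto simp: principal_ultrafilter_def\<close>)
  then show ?thesis unfolding free_part_def stone_basic_def by auto
qed

text \<open>A finite member would be a finite union of singletons, one of which would then be a member.\<close>

lemma free_ultrafilter_infinite:
  assumes "p \<in> free_part X B" "P \<in> p"
  shows "infinite P"
proof
  assume "finite P"
  have p: "ultrafilter_on X p" using assms free_part_iff by blast
  have "(\<Union>x\<in>P. {x}) \<in> p" using assms(2) by simp
  from ultrafilter_finite_Union[OF p \<open>finite P\<close> this]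
  obtain x where "x \<in> P" "{x} \<in> p" by blast
  moreover have "P \<subseteq> X" using ultrafilter_subset_carrier[OF p assms(2)] .
  ultimately show False using assms(1) by (auto simp: free_part_iff)
qed

lemma free_part_nonempty:
  assumes "infinite B" "B \<subseteq> X"
  shows "free_part X B \<noteq> {}"
proof -
  define E where "E = insert B {X - S | S. finite S}"
  obtain p where p: "ultrafilter_on X p" "E \<subseteq> p"
  proof (rule ultrafilter_extending[of E X])
    show "E \<subseteq> Pow X" using assms E_def by auto
    fix C assume C: "finite C" "C \<subseteq> E"
    have "finite (B - D)" if "D \<in> C" for D
    proof -
      have "D = B \<or> (\<exists>S. finite S \<and> D = X - S)" using that C(2) unfolding E_def by auto
      then show ?thesis using assms(2) by (auto intro: rev_finite_subset simp: Diff_Diff_Int)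
    qed
    then have "finite (\<Union>D\<in>C. B - D)" using C(1) by blast
    then have "B - (\<Union>D\<in>C. B - D) \<noteq> {}" using assms(1) by (metis finite.emptyI finite_Diff2)
    then show "X \<inter> \<Inter>C \<noteq> {}" using assms(2) by auto
  qed
  have "{x} \<notin> p" if "x \<in> X" for x
  proof -
    have "X - {x} \<in> E" unfolding E_def by blast
    then show ?thesis using p ultrafilter_Diff_iff[OF p(1), of "{x}"] that by auto
  qed
  moreover have "B \<in> p" using p(2) by (auto simp: E_def)
  ultimately have "p \<in> free_part X B" using p(1) by (simp add: free_part_iff)
  then show ?thesis by blast
qed

section \<open>Translates of ultrafilters\<close>

context group
begin

text \<open>Since \<open>Q\<close> is the translate by \<open>g\<close> of its preimage, membership in \<open>g p\<close> can be read off from the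
  preimage.\<close>

lemma mem_translate_ultrafilter:
  assumes p: "ultrafilter_on (carrier G) p" and g: "g \<in> carrier G"
  shows "Q \<in> translate_ultrafilter G g p \<longleftrightarrow> Q \<subseteq> carrier G \<and> {x \<in> carrier G. g \<otimes> x \<in> Q} \<in> p"
proof
  assume "Q \<in> translate_ultrafilter G g p"
  then obtain P where P: "P \<in> p" "Q = g <# P" unfolding translate_ultrafilter_def by blast
  then have "P \<subseteq> carrier G" using ultrafilter_subset_carrier[OF p] by blast
  then have "Q \<subseteq> carrier G" "P \<subseteq> {x \<in> carrier G. g \<otimes> x \<in> Q}"
    using P(2) g unfolding l_coset_def by auto
  then show "Q \<subseteq> carrier G \<and> {x \<in> carrier G. g \<otimes> x \<in> Q} \<in> p"
    using ultrafilter_superset[OF p P(1)] by auto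
next
  assume Q: "Q \<subseteq> carrier G \<and> {x \<in> carrier G. g \<otimes> x \<in> Q} \<in> p"
  have "y \<in> g <# {x \<in> carrier G. g \<otimes> x \<in> Q}" if "y \<in> Q" for y
  proof -
    have "y \<in> carrier G" using that Q by blast
    then have "y = g \<otimes> (inv g \<otimes> y)" "inv g \<otimes> y \<in> carrier G"
      using g by (simp_all add: m_assoc[symmetric])
    then show ?thesis using that unfolding l_coset_def by force
  qed
  then have "Q = g <# {x \<in> carrier G. g \<otimes> x \<in> Q}"
    unfolding l_coset_def by auto
  then show "Q \<in> translate_ultrafilter G g p"
    using Q unfolding translate_ultrafilter_def by blast
qed

lemma ultrafilter_translate:
  assumes p: "ultrafilter_on (carrier G) p" and g: "g \<in> carrier G"
  shows "ultrafilter_on (carrier G) (translate_ultrafilter G g p)"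
  unfolding ultrafilter_on_def
proof (intro conjI ballI allI impI)
  note mem = mem_translate_ultrafilter[OF p g]
  show "translate_ultrafilter G g p \<subseteq> Pow (carrier G)" using mem by blast
  have "{x \<in> carrier G. g \<otimes> x \<in> carrier G} = carrier G" using g by auto
  then show "carrier G \<in> translate_ultrafilter G g p" using mem ultrafilter_space[OF p] by simp
  show "{} \<notin> translate_ultrafilter G g p" using mem ultrafilter_nonempty[OF p] by fastforce
  show "P \<inter> Q \<in> translate_ultrafilter G g p"
    if "P \<in> translate_ultrafilter G g p" "Q \<in> translate_ultrafilter G g p" for P Q
  proof -
    have "{x \<in> carrier G. g \<otimes> x \<in> P \<inter> Q}
        = {x \<in> carrier G. g \<otimes> x \<in> P} \<inter> {x \<in> carrier G. g \<otimes> x \<in> Q}" by auto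
    then show ?thesis using that mem ultrafilter_Int[OF p] by auto
  qed
  show "Q \<in> translate_ultrafilter G g p"
    if "P \<in> translate_ultrafilter G g p" "P \<subseteq> Q \<and> Q \<subseteq> carrier G" for P Q
    using that mem ultrafilter_superset[OF p, of "{x \<in> carrier G. g \<otimes> x \<in> P}"
        "{x \<in> carrier G. g \<otimes> x \<in> Q}"] by auto
  show "P \<in> translate_ultrafilter G g p \<or> carrier G - P \<in> translate_ultrafilter G g p"
    if "P \<subseteq> carrier G" for P
  proof -
    have "{x \<in> carrier G. g \<otimes> x \<in> carrier G - P} = carrier G - {x \<in> carrier G. g \<otimes> x \<in> P}"
      using g by auto
    then show ?thesis using mem that ultrafilter_Diff_iff[OF p, of "{x \<in> carrier G. g \<otimes> x \<in> P}"]
      by auto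
  qed
qed

lemma translate_translate:
  assumes p: "ultrafilter_on (carrier G) p" and g: "g \<in> carrier G" and h: "h \<in> carrier G"
  shows "translate_ultrafilter G g (translate_ultrafilter G h p) = translate_ultrafilter G (g \<otimes> h) p"
proof -
  have "{x \<in> carrier G. h \<otimes> x \<in> {y \<in> carrier G. g \<otimes> y \<in> Q}} = {x \<in> carrier G. g \<otimes> h \<otimes> x \<in> Q}" for Q
    using g h by (auto simp: m_assoc)
  then show ?thesis
    using mem_translate_ultrafilter[OF p h]
      mem_translate_ultrafilter[OF ultrafilter_translate[OF p h] g]
      mem_translate_ultrafilter[OF p m_closed[OF g h]]
    by auto
qed

lemma translate_one:
  assumes p: "ultrafilter_on (carrier G) p"
  shows "translate_ultrafilter G \<one> p = p"
proof -
  have "{x \<in> carrier G. \<one> \<otimes> x \<in> Q} = Q" if "Q \<subseteq> carrier G" for Q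
    using that by auto
  then have "Q \<in> translate_ultrafilter G \<one> p \<longleftrightarrow> Q \<in> p" for Q
    using mem_translate_ultrafilter[OF p one_closed, of Q] ultrafilter_subset_carrier[OF p, of Q]
    by (cases "Q \<subseteq> carrier G") auto
  then show ?thesis by blast
qed

lemma free_part_translate:
  assumes p: "p \<in> free_part (carrier G) B" and g: "g \<in> carrier G"
    and C: "C \<in> translate_ultrafilter G g p"
  shows "translate_ultrafilter G g p \<in> free_part (carrier G) C"
proof -
  have u: "ultrafilter_on (carrier G) p" using p free_part_iff by blast
  have "{x} \<notin> translate_ultrafilter G g p" if "x \<in> carrier G" for x
  proof -
    have "{y \<in> carrier G. g \<otimes> y \<in> {x}} \<subseteq> {inv g \<otimes> x}"
      using g by (auto simp: m_assoc[symmetric])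
    then have "finite {y \<in> carrier G. g \<otimes> y \<in> {x}}" by (rule finite_subset) simp
    then show ?thesis
      using free_ultrafilter_infinite[OF p] mem_translate_ultrafilter[OF u g] by blast
  qed
  then show ?thesis using free_part_iff ultrafilter_translate[OF u g] C by blast
qed

text \<open>A group acts freely on its ultrafilters. If \<open>g \<noteq> \<one>\<close> and \<open>P\<close> is maximal among the sets
  disjoint from their translate by \<open>g\<close>, then every point lies in \<open>P\<close>, in \<open>g P\<close> or in
  \<open>g\<^sup>-\<^sup>1 P\<close>. One of these belongs to the ultrafilter; were the ultrafilter fixed by \<open>g\<close>, all of
  them would, although \<open>P\<close> and \<open>g P\<close> are disjoint.\<close>

lemma translate_fixed_imp_one:
  assumes p: "ultrafilter_on (carrier G) p" and g: "g \<in> carrier G"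
    and fix_p: "translate_ultrafilter G g p = p"
  shows "g = \<one>"
proof (rule ccontr)
  assume "g \<noteq> \<one>"
  define \<A> where "\<A> = {P. P \<subseteq> carrier G \<and> (\<forall>x\<in>P. g \<otimes> x \<notin> P)}"
  have "\<exists>M\<in>\<A>. \<forall>N\<in>\<A>. M \<subseteq> N \<longrightarrow> N = M"
  proof (rule subset_Zorn')
    fix \<C> assume ch: "subset.chain \<A> \<C>"
    then have sub: "\<C> \<subseteq> \<A>" and lin: "\<And>P Q. P \<in> \<C> \<Longrightarrow> Q \<in> \<C> \<Longrightarrow> P \<subseteq> Q \<or> Q \<subseteq> P"
      unfolding subset_chain_def by blast+
    have "g \<otimes> x \<notin> Q" if "x \<in> P" "P \<in> \<C>" "Q \<in> \<C>" for x P Q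
      using lin[OF that(2,3)] that sub unfolding \<A>_def by blast
    then show "\<Union>\<C> \<in> \<A>" using sub unfolding \<A>_def by blast
  qed
  then obtain P where P: "P \<in> \<A>" and max: "\<And>N. N \<in> \<A> \<Longrightarrow> P \<subseteq> N \<Longrightarrow> N = P" by blast
  have PG: "P \<subseteq> carrier G" and dis: "\<And>x. x \<in> P \<Longrightarrow> g \<otimes> x \<notin> P"
    using P unfolding \<A>_def by blast+
  define pre where "pre Q = {x \<in> carrier G. g \<otimes> x \<in> Q}" for Q
  have inv_iff: "pre Q \<in> p \<longleftrightarrow> Q \<in> p" if "Q \<subseteq> carrier G" for Q
    using mem_translate_ultrafilter[OF p g, of Q] fix_p that unfolding pre_def by simp
  have "x \<in> P \<union> pre P \<union> (\<lambda>y. g \<otimes> y) ` P" if x: "x \<in> carrier G" for x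
  proof (rule ccontr)
    assume nx: "x \<notin> P \<union> pre P \<union> (\<lambda>y. g \<otimes> y) ` P"
    have "g \<otimes> x \<noteq> x" using \<open>g \<noteq> \<one>\<close> g x by simp
    then have "insert x P \<in> \<A>" using nx x PG dis unfolding \<A>_def pre_def by auto
    then show False using max nx by blast
  qed
  then have cover: "P \<union> pre P \<union> (\<lambda>y. g \<otimes> y) ` P = carrier G"
    using PG g unfolding pre_def by auto
  have img: "pre ((\<lambda>y. g \<otimes> y) ` P) = P"
    using PG g unfolding pre_def by auto
  have imgG: "(\<lambda>y. g \<otimes> y) ` P \<subseteq> carrier G" using PG g by auto
  have "P \<in> p"
  proof (rule ccontr)
    assume "P \<notin> p"
    then have "pre P \<notin> p" "(\<lambda>y. g \<otimes> y) ` P \<notin> p"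
      using inv_iff[OF PG] inv_iff[OF imgG] img by auto
    moreover have "pre P \<subseteq> carrier G" unfolding pre_def by auto
    ultimately have "(carrier G - P) \<inter> ((carrier G - pre P) \<inter> (carrier G - (\<lambda>y. g \<otimes> y) ` P)) \<in> p"
      using \<open>P \<notin> p\<close> ultrafilter_Diff_iff[OF p] ultrafilter_Int[OF p] PG imgG by metis
    moreover have "(carrier G - P) \<inter> ((carrier G - pre P) \<inter> (carrier G - (\<lambda>y. g \<otimes> y) ` P)) = {}"
      using cover by blast
    ultimately show False using ultrafilter_nonempty[OF p] by metis
  qed
  then have "P \<inter> pre P \<in> p" using inv_iff[OF PG] ultrafilter_Int[OF p] by blast
  moreover have "P \<inter> pre P = {}" using dis unfolding pre_def by blast
  ultimately show False using ultrafilter_nonempty[OF p] by metis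
qed

lemma translate_ultrafilter_inj:
  assumes p: "ultrafilter_on (carrier G) p" and g: "g \<in> carrier G" and h: "h \<in> carrier G"
    and eq: "translate_ultrafilter G g p = translate_ultrafilter G h p"
  shows "g = h"
proof -
  have "translate_ultrafilter G (inv h \<otimes> g) p = translate_ultrafilter G (inv h \<otimes> h) p"
    using eq translate_translate[OF p] g h by (metis inv_closed)
  then have "translate_ultrafilter G (inv h \<otimes> g) p = p"
    using translate_one[OF p] h by simp
  then have "inv h \<otimes> g = \<one>" using translate_fixed_imp_one[OF p] g h by simp
  then show ?thesis using g h by (metis inv_equality inv_inv inv_closed)
qed

end

section \<open>Coarse copies of infinite groups are not scattered\<close>

lemma coarse_ball_iff:
  "z \<in> coarse_ball G Y y F \<longleftrightarrow> z \<in> Y \<and> (z = y \<or> (\<exists>h\<in>F. z = h \<otimes>\<^bsub>G\<^esub> y))"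
  unfolding coarse_ball_def r_coset_def by auto

context group
begin

text \<open>The subset \<open>X\<close> of \<open>S\<close> that is asymorphic to a large subset \<open>Y\<close> of \<open>H\<close> has only infinite
  ultracompanions at its own free ultrafilters \<open>q\<close>. The asymorphism \<open>f\<close> moves each shift by
  \<open>d \<in> H\<close> that maps \<open>q\<close>-almost all of \<open>Y\<close> into \<open>Y\<close> to a partial map of \<open>X\<close>. This map moves points by
  elements of a finite set, and \<open>q\<close> selects one of them, \<open>h d\<close>, which works on a member of \<open>q\<close>.\<close>

lemma coarse_copy_imp_not_scattered:
  assumes "group H" and inf: "infinite (carrier H)"
    and ce: "coarsely_equivalent G S H (carrier H)"
    and "S \<subseteq> A" "A \<subseteq> carrier G"
  shows "\<not> scattered G A"
proof -
  interpret H: group H by fact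
  obtain X Y f K where XS: "X \<subseteq> S" and YH: "Y \<subseteq> carrier H" and f: "bij_betw f X Y"
    and prec: "prec_mapping H Y G X (inv_into X f)"
    and K: "finite K" "K \<subseteq> carrier H" and "carrier H \<subseteq> coarse_nbhd H (carrier H) Y K"
    using ce unfolding coarsely_equivalent_def asymorphic_def asymorphism_def
    by (elim exE conjE) (rule that)
  then have large: "\<exists>k\<in>insert \<one>\<^bsub>H\<^esub> K. \<exists>y\<in>Y. v = k \<otimes>\<^bsub>H\<^esub> y" if v: "v \<in> carrier H" for v
  proof -
    obtain y where "y \<in> Y" "v \<in> coarse_ball H (carrier H) y K"
      using v \<open>carrier H \<subseteq> _\<close> unfolding coarse_nbhd_def by blast
    moreover have "y = \<one>\<^bsub>H\<^esub> \<otimes>\<^bsub>H\<^esub> y" using \<open>y \<in> Y\<close> YH by auto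
    ultimately show ?thesis unfolding coarse_ball_iff by blast
  qed
  have finK: "finite (insert \<one>\<^bsub>H\<^esub> K)" and KH: "insert \<one>\<^bsub>H\<^esub> K \<subseteq> carrier H"
    using K by auto
  have XG: "X \<subseteq> carrier G" using XS assms by blast
  define \<phi> where "\<phi> = inv_into X f"
  have \<phi>f: "\<phi> (f x) = x" if "x \<in> X" for x
    using that f unfolding \<phi>_def by (simp add: bij_betw_inv_into_left)
  have f\<phi>: "f (\<phi> y) = y" if "y \<in> Y" for y
    using that f unfolding \<phi>_def by (simp add: bij_betw_inv_into_right)
  have fY: "f x \<in> Y" if "x \<in> X" for x using that f bij_betwE by blast
  \<comment> \<open>Finitely many translates of such a set cover \<open>H\<close>, so it cannot be finite.\<close>
  have cofinitely_large: "infinite D"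
    if "\<And>v. v \<in> carrier H \<Longrightarrow> \<exists>k\<in>insert \<one>\<^bsub>H\<^esub> K. \<exists>d\<in>D. v = k \<otimes>\<^bsub>H\<^esub> d" for D
  proof
    assume "finite D"
    then have "finite ((\<lambda>(k, d). k \<otimes>\<^bsub>H\<^esub> d) ` (insert \<one>\<^bsub>H\<^esub> K \<times> D))" using finK by blast
    moreover have "carrier H \<subseteq> (\<lambda>(k, d). k \<otimes>\<^bsub>H\<^esub> d) ` (insert \<one>\<^bsub>H\<^esub> K \<times> D)"
      using that by force
    ultimately show False using inf finite_subset by blast
  qed
  have "infinite Y" using cofinitely_large[OF large] .
  then have "infinite X" using f bij_betw_finite by blast
  have "infinite (ultracompanion G q X)" if q: "q \<in> free_part (carrier G) X" for q
  proof -
    have u: "ultrafilter_on (carrier G) q" and "X \<in> q" using q free_part_iff by blast+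
    define E where "E d = {x \<in> X. d \<otimes>\<^bsub>H\<^esub> f x \<in> Y}" for d
    define D where "D = {d \<in> carrier H. E d \<in> q}"
    have "infinite D"
    proof (rule cofinitely_large)
      fix v assume v: "v \<in> carrier H"
      \<comment> \<open>Largeness of \<open>Y\<close> brings each \<open>v \<otimes> f x\<close> back into \<open>Y\<close> after division by one of finitely
        many \<open>k\<close>, and \<open>q\<close> selects one \<open>k\<close> for almost all \<open>x\<close>.\<close>
      have Xeq: "X = (\<Union>k\<in>insert \<one>\<^bsub>H\<^esub> K. E (inv\<^bsub>H\<^esub> k \<otimes>\<^bsub>H\<^esub> v))"
      proof
        show "X \<subseteq> (\<Union>k\<in>insert \<one>\<^bsub>H\<^esub> K. E (inv\<^bsub>H\<^esub> k \<otimes>\<^bsub>H\<^esub> v))"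
        proof
          fix x assume x: "x \<in> X"
          then have fx: "f x \<in> carrier H" using fY YH by blast
          obtain k y where k: "k \<in> insert \<one>\<^bsub>H\<^esub> K" and y: "y \<in> Y" and eq: "v \<otimes>\<^bsub>H\<^esub> f x = k \<otimes>\<^bsub>H\<^esub> y"
            using large[OF H.m_closed[OF v fx]] by blast
          have "k \<in> carrier H" "y \<in> carrier H" using k y KH YH by blast+
          then have "inv\<^bsub>H\<^esub> k \<otimes>\<^bsub>H\<^esub> v \<otimes>\<^bsub>H\<^esub> f x = y"
            using eq v fx by (simp add: H.m_assoc) (simp add: H.m_assoc[symmetric])
          then show "x \<in> (\<Union>k\<in>insert \<one>\<^bsub>H\<^esub> K. E (inv\<^bsub>H\<^esub> k \<otimes>\<^bsub>H\<^esub> v))"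
            using k x y unfolding E_def by auto
        qed
      qed (auto simp: E_def)
      have "(\<Union>k\<in>insert \<one>\<^bsub>H\<^esub> K. E (inv\<^bsub>H\<^esub> k \<otimes>\<^bsub>H\<^esub> v)) \<in> q"
        by (rule subst[OF Xeq, of "\<lambda>S. S \<in> q"]) (fact \<open>X \<in> q\<close>)
      from ultrafilter_finite_Union[OF u finK this]
      obtain k where k: "k \<in> insert \<one>\<^bsub>H\<^esub> K" "E (inv\<^bsub>H\<^esub> k \<otimes>\<^bsub>H\<^esub> v) \<in> q" by blast
      moreover have "k \<in> carrier H" using k KH by blast
      ultimately have "inv\<^bsub>H\<^esub> k \<otimes>\<^bsub>H\<^esub> v \<in> D" "v = k \<otimes>\<^bsub>H\<^esub> (inv\<^bsub>H\<^esub> k \<otimes>\<^bsub>H\<^esub> v)"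
        using v unfolding D_def by (simp_all add: H.m_assoc[symmetric])
      then show "\<exists>k\<in>insert \<one>\<^bsub>H\<^esub> K. \<exists>d\<in>D. v = k \<otimes>\<^bsub>H\<^esub> d" using k by blast
    qed
    have "\<exists>h\<in>carrier G. {x \<in> E d. \<phi> (d \<otimes>\<^bsub>H\<^esub> f x) = h \<otimes> x} \<in> q" if d: "d \<in> D" for d
    proof -
      have dH: "d \<in> carrier H" and Ed: "E d \<in> q" using d D_def by auto
      have "\<exists>L. finite L \<and> L \<subseteq> carrier G \<and>
          (\<forall>y\<in>Y. \<phi> ` coarse_ball H Y y {d} \<subseteq> coarse_ball G X (\<phi> y) L)"
      proof -
        have "\<forall>F. finite F \<and> F \<subseteq> carrier H \<longrightarrow> (\<exists>L. finite L \<and> L \<subseteq> carrier G \<and>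
            (\<forall>y\<in>Y. \<phi> ` coarse_ball H Y y F \<subseteq> coarse_ball G X (\<phi> y) L))"
          using prec unfolding prec_mapping_def \<phi>_def by (rule conjunct2)
        from this[THEN spec, of "{d}"] show ?thesis using dH by (elim impE) auto
      qed
      then obtain L where L: "finite L" "L \<subseteq> carrier G"
        and ball: "\<forall>y\<in>Y. \<phi> ` coarse_ball H Y y {d} \<subseteq> coarse_ball G X (\<phi> y) L"
        by (elim exE conjE) (rule that)
      have Edeq: "E d = (\<Union>h\<in>insert \<one> L. {x \<in> E d. \<phi> (d \<otimes>\<^bsub>H\<^esub> f x) = h \<otimes> x})"
      proof
        show "E d \<subseteq> (\<Union>h\<in>insert \<one> L. {x \<in> E d. \<phi> (d \<otimes>\<^bsub>H\<^esub> f x) = h \<otimes> x})"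
        proof
          fix x assume x: "x \<in> E d"
          then have xX: "x \<in> X" and "d \<otimes>\<^bsub>H\<^esub> f x \<in> coarse_ball H Y (f x) {d}"
            unfolding E_def coarse_ball_iff by auto
          then have "\<phi> (d \<otimes>\<^bsub>H\<^esub> f x) \<in> coarse_ball G X x L"
            using bspec[OF ball fY[OF xX]] \<phi>f[OF xX] by auto
          moreover have "x = \<one> \<otimes> x" using xX XG by auto
          ultimately have "\<exists>h\<in>insert \<one> L. \<phi> (d \<otimes>\<^bsub>H\<^esub> f x) = h \<otimes> x"
            unfolding coarse_ball_iff by auto
          then show "x \<in> (\<Union>h\<in>insert \<one> L. {x \<in> E d. \<phi> (d \<otimes>\<^bsub>H\<^esub> f x) = h \<otimes> x})"
            using x by blast
        qed
      qed blast
      have "(\<Union>h\<in>insert \<one> L. {x \<in> E d. \<phi> (d \<otimes>\<^bsub>H\<^esub> f x) = h \<otimes> x}) \<in> q"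
        by (rule subst[OF Edeq, of "\<lambda>S. S \<in> q"]) (fact Ed)
      from ultrafilter_finite_Union[OF u _ this]
      obtain h where "h \<in> insert \<one> L" "{x \<in> E d. \<phi> (d \<otimes>\<^bsub>H\<^esub> f x) = h \<otimes> x} \<in> q"
        using L(1) by blast
      then show ?thesis using L(2) one_closed by blast
    qed
    then have "\<forall>d\<in>D. \<exists>h. h \<in> carrier G \<and> {x \<in> E d. \<phi> (d \<otimes>\<^bsub>H\<^esub> f x) = h \<otimes> x} \<in> q"
      by blast
    from bchoice[OF this] obtain h where hG: "\<And>d. d \<in> D \<Longrightarrow> h d \<in> carrier G"
      and h: "\<And>d. d \<in> D \<Longrightarrow> {x \<in> E d. \<phi> (d \<otimes>\<^bsub>H\<^esub> f x) = h d \<otimes> x} \<in> q"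
      by blast
    have "inj_on h D"
    proof (rule inj_onI)
      fix d d' assume d: "d \<in> D" and d': "d' \<in> D" and eq: "h d = h d'"
      obtain x where "x \<in> E d" "\<phi> (d \<otimes>\<^bsub>H\<^esub> f x) = h d \<otimes> x" "x \<in> E d'" "\<phi> (d' \<otimes>\<^bsub>H\<^esub> f x) = h d' \<otimes> x"
        using ultrafilter_nonempty[OF u ultrafilter_Int[OF u h[OF d] h[OF d']]] by auto
      then have x: "x \<in> X" and "d \<otimes>\<^bsub>H\<^esub> f x = d' \<otimes>\<^bsub>H\<^esub> f x"
        using eq f\<phi> unfolding E_def by (auto, metis)
      moreover have "f x \<in> carrier H" "d \<in> carrier H" "d' \<in> carrier H"
        using fY[OF x] YH d d' unfolding D_def by auto
      ultimately show "d = d'" by (metis H.right_cancel)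
    qed
    then have "inj_on (\<lambda>d. translate_ultrafilter G (h d) q) D"
      using translate_ultrafilter_inj[OF u hG hG] unfolding inj_on_def by blast
    moreover have "translate_ultrafilter G (h d) q \<in> ultracompanion G q X" if d: "d \<in> D" for d
    proof -
      have "\<phi> y \<in> X" if "y \<in> Y" for y
        using prec that unfolding prec_mapping_def \<phi>_def by blast
      then have "{x \<in> E d. \<phi> (d \<otimes>\<^bsub>H\<^esub> f x) = h d \<otimes> x} \<subseteq> {x \<in> carrier G. h d \<otimes> x \<in> X}"
        using XG unfolding E_def by force
      then have "{x \<in> carrier G. h d \<otimes> x \<in> X} \<in> q"
        using ultrafilter_superset[OF u h[OF d]] by blast
      then have "X \<in> translate_ultrafilter G (h d) q"
        using mem_translate_ultrafilter[OF u hG[OF d]] XG by blast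
      then show ?thesis
        using free_part_translate[OF q hG[OF d]] hG[OF d]
        unfolding ultracompanion_def ultrafilter_orbit_def by blast
    qed
    ultimately show ?thesis
      using \<open>infinite D\<close> by (metis (no_types, lifting) finite_imageD finite_subset image_subsetI)
  qed
  then show ?thesis
    using \<open>infinite X\<close> XS \<open>S \<subseteq> A\<close> unfolding scattered_def by blast
qed

end

section \<open>Disparse sets are scattered\<close>

text \<open>The basic sets generate the topology as a subbase; closure under finite intersections makes
  them a base.\<close>

lemma openin_stone_cech_basic_nbhd:
  assumes "openin (stone_cech X) T" "p \<in> T" "ultrafilter_on X p"
  obtains U where "U \<in> p" "U \<subseteq> X" "stone_basic X U \<subseteq> T"
proof -
  have "generate_topology_on {stone_basic X A |A. A \<subseteq> X} T"
    using assms(1) unfolding stone_cech_def openin_topology_generated_by_iff .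
  then have "p \<in> T \<Longrightarrow> \<exists>U. U \<in> p \<and> U \<subseteq> X \<and> stone_basic X U \<subseteq> T"
  proof (induction rule: generate_topology_on.induct)
    case (Int S T)
    then obtain U V where "U \<in> p" "U \<subseteq> X" "stone_basic X U \<subseteq> S" "V \<in> p" "V \<subseteq> X" "stone_basic X V \<subseteq> T"
      by auto
    then show ?case
      using stone_basic_Int[of U X V] ultrafilter_Int[OF assms(3), of U V]
      by (intro exI[of _ "U \<inter> V"]) auto
  next
    case (UN \<K>)
    then obtain S where "S \<in> \<K>" "p \<in> S" by blast
    with UN.IH[OF this] show ?case by blast
  next
    case (Basis S)
    then show ?case unfolding stone_basic_def by blast
  qed simp
  then show thesis using assms(2) that by blast
qed

lemma openin_stone_basic: "U \<subseteq> X \<Longrightarrow> openin (stone_cech X) (stone_basic X U)"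
  unfolding stone_cech_def by (rule topology_generated_by_Basis) blast

context group
begin

text \<open>Every point of an ultracompanion \<open>\<Delta>\<^sub>p(A)\<close> lies in \<open>A\<^sup>*\<close> and has the same orbit as \<open>p\<close>, so it is
  enough to isolate each \<open>q \<in> A\<^sup>*\<close> in its own ultracompanion. As the action is free, a basic
  neighbourhood \<open>U\<close> isolates \<open>q\<close> when no \<open>g \<noteq> \<one>\<close> moves \<open>q\<close> into it.\<close>

lemma disparse_iff_isolated:
  assumes AG: "A \<subseteq> carrier G"
  shows "disparse G A \<longleftrightarrow>
    (\<forall>q\<in>free_part (carrier G) A. \<exists>U\<in>q. \<forall>g\<in>carrier G. U \<in> translate_ultrafilter G g q \<longrightarrow> g = \<one>)"
    (is "_ \<longleftrightarrow> ?isolated")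
proof
  assume dis: "disparse G A"
  show ?isolated
  proof
    fix q assume q: "q \<in> free_part (carrier G) A"
    then have u: "ultrafilter_on (carrier G) q" and "A \<in> q" using free_part_iff by blast+
    have "q \<in> free_part (carrier G) (carrier G)"
      using q ultrafilter_space[OF u] by (simp add: free_part_iff)
    then have top: "subtopology (stone_cech (carrier G)) (ultracompanion G q A)
          = discrete_topology (ultracompanion G q A)"
      using dis unfolding disparse_def by blast
    have "q \<in> ultracompanion G q A"
      using q translate_one[OF u] one_closed
      unfolding ultracompanion_def ultrafilter_orbit_def by (auto intro: exI[of _ \<one>])
    then have "openin (subtopology (stone_cech (carrier G)) (ultracompanion G q A)) {q}"
      unfolding top by simp
    then obtain T where T: "openin (stone_cech (carrier G)) T" "{q} = T \<inter> ultracompanion G q A"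
      unfolding openin_subtopology by blast
    then have "q \<in> T" by blast
    then obtain U where U: "U \<in> q" "U \<subseteq> carrier G" "stone_basic (carrier G) U \<subseteq> T"
      using openin_stone_cech_basic_nbhd[OF T(1) _ u] by metis
    have "g = \<one>" if g: "g \<in> carrier G" and mem: "U \<inter> A \<in> translate_ultrafilter G g q" for g
    proof -
      have ug: "ultrafilter_on (carrier G) (translate_ultrafilter G g q)"
        by (rule ultrafilter_translate[OF u g])
      have "U \<in> translate_ultrafilter G g q" "A \<in> translate_ultrafilter G g q"
        using ultrafilter_superset[OF ug mem] U(2) AG by auto
      then have "translate_ultrafilter G g q \<in> T \<inter> ultracompanion G q A"
        using U(3) ug free_part_translate[OF q g] g
        unfolding ultracompanion_def ultrafilter_orbit_def stone_basic_def by auto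
      then have "translate_ultrafilter G g q = q" using T(2) by blast
      then show ?thesis by (rule translate_fixed_imp_one[OF u g])
    qed
    then show "\<exists>U\<in>q. \<forall>g\<in>carrier G. U \<in> translate_ultrafilter G g q \<longrightarrow> g = \<one>"
      using ultrafilter_Int[OF u U(1) \<open>A \<in> q\<close>] by blast
  qed
next
  assume iso: ?isolated
  show "disparse G A"
    unfolding disparse_def
  proof
    fix p assume p: "p \<in> free_part (carrier G) (carrier G)"
    then have u: "ultrafilter_on (carrier G) p" by (simp add: free_part_iff)
    let ?\<Delta> = "ultracompanion G p A" and ?\<beta> = "stone_cech (carrier G)"
    have "?\<Delta> \<subseteq> topspace ?\<beta>"
      unfolding ultracompanion_def topspace_stone_cech by (auto simp: free_part_iff)
    then have "topspace (subtopology ?\<beta> ?\<Delta>) = ?\<Delta>" by (simp add: topspace_subtopology Int_absorb1)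
    moreover have "openin (subtopology ?\<beta> ?\<Delta>) {q}" if q: "q \<in> ?\<Delta>" for q
    proof -
      obtain g where g: "g \<in> carrier G" "q = translate_ultrafilter G g p"
        and qA: "q \<in> free_part (carrier G) A"
        using q unfolding ultracompanion_def ultrafilter_orbit_def by blast
      obtain U where U: "U \<in> q" "\<And>h. h \<in> carrier G \<Longrightarrow> U \<in> translate_ultrafilter G h q \<Longrightarrow> h = \<one>"
        using iso qA by blast
      have uq: "ultrafilter_on (carrier G) q" using qA by (simp add: free_part_iff)
      have "r = q" if r: "r \<in> stone_basic (carrier G) U" "r \<in> ?\<Delta>" for r
      proof -
        obtain h where h: "h \<in> carrier G" "r = translate_ultrafilter G h p"
          using r(2) unfolding ultracompanion_def ultrafilter_orbit_def by blast
        then have rq: "r = translate_ultrafilter G (h \<otimes> inv g) q"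
          using g translate_translate[OF u, of "h \<otimes> inv g" g] by (simp add: m_assoc)
        then have "h \<otimes> inv g = \<one>" using U(2) r(1) h(1) g(1) by (simp add: stone_basic_def)
        then show "r = q" using rq translate_one[OF uq] by simp
      qed
      moreover have "q \<in> stone_basic (carrier G) U" using U(1) uq by (simp add: stone_basic_def)
      ultimately have "{q} = stone_basic (carrier G) U \<inter> ?\<Delta>" using q by blast
      moreover have "openin ?\<beta> (stone_basic (carrier G) U)"
        using openin_stone_basic ultrafilter_subset_carrier[OF uq U(1)] .
      ultimately show ?thesis unfolding openin_subtopology by blast
    qed
    ultimately show "subtopology ?\<beta> ?\<Delta> = discrete_topology ?\<Delta>"
      by (metis discrete_topology_unique)
  qed
qed

text \<open>For \<open>p \<in> Y\<^sup>*\<close>, the ultrafilters that extend this family are the members of \<open>Y\<^sup>*\<close> in the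
  closure of the orbit of \<open>p\<close>. A larger family thus means a smaller orbit closure,
  and a maximal family a minimal one.\<close>

definition orbit_closure_family :: "'a set \<Rightarrow> 'a set set \<Rightarrow> 'a set set" where
  "orbit_closure_family Y p =
     {P. P \<subseteq> carrier G \<and> (\<forall>g\<in>carrier G. P \<union> (carrier G - Y) \<in> translate_ultrafilter G g p)}"

lemma orbit_closure_family_subset_translate:
  assumes p: "p \<in> free_part (carrier G) Y" and g: "g \<in> carrier G"
    and Y: "Y \<in> translate_ultrafilter G g p"
  shows "orbit_closure_family Y p \<subseteq> translate_ultrafilter G g p"
proof
  fix P assume P: "P \<in> orbit_closure_family Y p"
  have u: "ultrafilter_on (carrier G) (translate_ultrafilter G g p)"
    using ultrafilter_translate[OF _ g] p by (simp add: free_part_iff)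
  have "P \<union> (carrier G - Y) \<in> translate_ultrafilter G g p" and PG: "P \<subseteq> carrier G"
    using P g unfolding orbit_closure_family_def by auto
  from ultrafilter_Int[OF u this(1) Y] show "P \<in> translate_ultrafilter G g p"
    by (rule ultrafilter_superset[OF u]) (use PG in auto)
qed

lemma orbit_closure_family_subset:
  assumes p: "p \<in> free_part (carrier G) Y"
  shows "orbit_closure_family Y p \<subseteq> p"
  using orbit_closure_family_subset_translate[OF p one_closed] translate_one p
  by (simp add: free_part_iff)

text \<open>Complements of points and the set \<open>Y\<close> belong to the family because all translates of a free
  ultrafilter are free; hence its extensions are members of \<open>Y\<^sup>*\<close>.\<close>

lemma orbit_closure_family_free:
  assumes p: "p \<in> free_part (carrier G) Y" and q: "ultrafilter_on (carrier G) q"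
    and sub: "orbit_closure_family Y p \<subseteq> q" and YG: "Y \<subseteq> carrier G"
  shows "q \<in> free_part (carrier G) Y"
proof -
  have u: "ultrafilter_on (carrier G) p" using p by (simp add: free_part_iff)
  have "Y \<union> (carrier G - Y) = carrier G" using YG by blast
  then have "Y \<in> orbit_closure_family Y p"
    using ultrafilter_space[OF ultrafilter_translate[OF u]] YG
    unfolding orbit_closure_family_def by auto
  moreover have "{x} \<notin> q" if x: "x \<in> carrier G" for x
  proof -
    have "carrier G - {x} \<union> (carrier G - Y) \<in> translate_ultrafilter G g p" if g: "g \<in> carrier G" for g
    proof -
      have ug: "ultrafilter_on (carrier G) (translate_ultrafilter G g p)"
        by (rule ultrafilter_translate[OF u g])
      then have "{x} \<notin> translate_ultrafilter G g p"
        using free_part_translate[OF p g ultrafilter_space[OF ug]] x by (auto simp: free_part_iff)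
      then have "carrier G - {x} \<in> translate_ultrafilter G g p"
        using ultrafilter_Diff_iff[OF ug] x by simp
      then show ?thesis by (rule ultrafilter_superset[OF ug]) auto
    qed
    then have "carrier G - {x} \<in> q" using sub unfolding orbit_closure_family_def by blast
    then show ?thesis using ultrafilter_Diff_iff[OF q, of "{x}"] x by simp
  qed
  ultimately show ?thesis using q sub by (auto simp: free_part_iff)
qed

text \<open>A point \<open>q\<close> in the closure of the orbit of \<open>p\<close> has its own orbit closure inside that closure,
  because the closure of an orbit is invariant under translation.\<close>

lemma orbit_closure_family_mono:
  assumes p: "ultrafilter_on (carrier G) p" and q: "ultrafilter_on (carrier G) q"
    and sub: "orbit_closure_family Y p \<subseteq> q"
  shows "orbit_closure_family Y p \<subseteq> orbit_closure_family Y q"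
proof
  fix P assume P: "P \<in> orbit_closure_family Y p"
  then have PG: "P \<subseteq> carrier G" by (simp add: orbit_closure_family_def)
  have "P \<union> (carrier G - Y) \<in> translate_ultrafilter G g q" if g: "g \<in> carrier G" for g
  proof -
    define Q where "Q = {x \<in> carrier G. g \<otimes> x \<in> P \<union> (carrier G - Y)}"
    have "Q \<union> (carrier G - Y) \<in> translate_ultrafilter G h p" if h: "h \<in> carrier G" for h
    proof -
      have "P \<union> (carrier G - Y) \<in> translate_ultrafilter G (g \<otimes> h) p"
        using P g h by (simp add: orbit_closure_family_def)
      then have "Q \<in> translate_ultrafilter G h p"
        using mem_translate_ultrafilter[OF ultrafilter_translate[OF p h] g]
        unfolding translate_translate[OF p g h, symmetric] Q_def by blast
      then show ?thesis
        by (rule ultrafilter_superset[OF ultrafilter_translate[OF p h]]) (auto simp: Q_def)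
    qed
    then have "Q \<in> orbit_closure_family Y p" by (auto simp: orbit_closure_family_def Q_def)
    then show ?thesis
      using sub mem_translate_ultrafilter[OF q g] PG unfolding Q_def by auto
  qed
  then show "P \<in> orbit_closure_family Y q" using PG by (simp add: orbit_closure_family_def)
qed

text \<open>Minimal orbit closures exist by Zorn's lemma: an ultrafilter that extends the union of a chain
  of families lies in all the corresponding orbit closures, so its own orbit closure is below them
  all.\<close>

lemma maximal_orbit_closure_family:
  assumes "infinite Y" and YG: "Y \<subseteq> carrier G"
  obtains p where "p \<in> free_part (carrier G) Y"
    and "\<And>q. ultrafilter_on (carrier G) q \<Longrightarrow> orbit_closure_family Y p \<subseteq> q \<Longrightarrow>
      orbit_closure_family Y q = orbit_closure_family Y p"
proof -
  let ?\<Phi> = "orbit_closure_family Y"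
  define \<A> where "\<A> = ?\<Phi> ` free_part (carrier G) Y"
  have "\<exists>M\<in>\<A>. \<forall>N\<in>\<A>. M \<subseteq> N \<longrightarrow> N = M"
  proof (rule subset_Zorn)
    fix \<C> assume ch: "subset.chain \<A> \<C>"
    then have sub: "\<C> \<subseteq> \<A>" by (simp add: subset_chain_def)
    show "\<exists>U\<in>\<A>. \<forall>M\<in>\<C>. M \<subseteq> U"
    proof (cases "\<C> = {}")
      case True
      then show ?thesis using free_part_nonempty[OF assms] \<A>_def by auto
    next
      case False
      obtain q where q: "ultrafilter_on (carrier G) q" "\<Union>\<C> \<subseteq> q"
      proof (rule ultrafilter_extending)
        show "\<Union>\<C> \<subseteq> Pow (carrier G)"
          using sub unfolding \<A>_def orbit_closure_family_def by fastforce
        fix C assume C: "finite C" "C \<subseteq> \<Union>\<C>"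
        obtain B where "B \<in> \<C>" "C \<subseteq> B" using finite_subset_Union_chain[OF C False ch] by blast
        then obtain p where p: "p \<in> free_part (carrier G) Y" "C \<subseteq> ?\<Phi> p" using sub \<A>_def by auto
        then have u: "ultrafilter_on (carrier G) p" and "C \<subseteq> p"
          using orbit_closure_family_subset[OF p(1)] by (auto simp: free_part_iff)
        show "carrier G \<inter> \<Inter>C \<noteq> {}"
          using ultrafilter_nonempty[OF u ultrafilter_finite_Inter[OF u C(1) \<open>C \<subseteq> p\<close>]] .
      qed
      have up: "q \<in> free_part (carrier G) Y \<and> M \<subseteq> ?\<Phi> q" if M: "M \<in> \<C>" for M
      proof -
        obtain p where p: "p \<in> free_part (carrier G) Y" "M = ?\<Phi> p"
          using M sub unfolding \<A>_def by auto
        moreover have "?\<Phi> p \<subseteq> q" using M p(2) q(2) by blast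
        moreover have "ultrafilter_on (carrier G) p" using p(1) by (simp add: free_part_iff)
        ultimately show ?thesis
          using orbit_closure_family_free[OF _ q(1) _ YG] orbit_closure_family_mono[OF _ q(1)]
          by blast
      qed
      then have "?\<Phi> q \<in> \<A>" using False unfolding \<A>_def by blast
      then show ?thesis using up by blast
    qed
  qed
  then obtain p where p: "p \<in> free_part (carrier G) Y"
    and max: "\<And>q. q \<in> free_part (carrier G) Y \<Longrightarrow> ?\<Phi> p \<subseteq> ?\<Phi> q \<Longrightarrow> ?\<Phi> q = ?\<Phi> p"
    unfolding \<A>_def by auto
  show thesis
  proof (rule that[OF p])
    fix q assume q: "ultrafilter_on (carrier G) q" "?\<Phi> p \<subseteq> q"
    have "ultrafilter_on (carrier G) p" using p by (simp add: free_part_iff)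
    then show "?\<Phi> q = ?\<Phi> p"
      using max orbit_closure_family_free[OF p q YG] orbit_closure_family_mono q by blast
  qed
qed

text \<open>Let \<open>Z\<close> be the set of ultrafilters extending a maximal family. Each \<open>q \<in> Z\<close> is isolated in
  its ultracompanion by some \<open>U q\<close>. The orbit of \<open>q\<close> being dense in \<open>Z\<close>, the neighbourhood
  \<open>U q\<close> meets \<open>Z\<close> in \<open>q\<close> alone (\<open>unique\<close>). If \<open>Z\<close> were infinite, the complements of all \<open>U q\<close> would
  be compatible with the family, giving a point of \<open>Z\<close> outside its own neighbourhood.\<close>

lemma disparse_imp_scattered:
  assumes AG: "A \<subseteq> carrier G" and dis: "disparse G A"
  shows "scattered G A"
  unfolding scattered_def
proof (intro allI impI)
  fix Y assume "Y \<subseteq> A \<and> infinite Y"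
  then have YA: "Y \<subseteq> A" and "infinite Y" and YG: "Y \<subseteq> carrier G" using AG by auto
  let ?\<Phi> = "orbit_closure_family Y"
  obtain p where p: "p \<in> free_part (carrier G) Y"
    and max: "\<And>q. ultrafilter_on (carrier G) q \<Longrightarrow> ?\<Phi> p \<subseteq> q \<Longrightarrow> ?\<Phi> q = ?\<Phi> p"
    using maximal_orbit_closure_family[OF \<open>infinite Y\<close> YG] by blast
  define Z where "Z = {q. ultrafilter_on (carrier G) q \<and> ?\<Phi> p \<subseteq> q}"
  have "\<exists>U. U \<in> q \<and> (\<forall>g\<in>carrier G. U \<in> translate_ultrafilter G g q \<longrightarrow> g = \<one>)" if q: "q \<in> Z" for q
  proof -
    have q': "q \<in> free_part (carrier G) Y"
      using q orbit_closure_family_free[OF p _ _ YG] by (simp add: Z_def)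
    then have "A \<in> q" using ultrafilter_superset[of "carrier G" q Y A] YA AG by (simp add: free_part_iff)
    then have "q \<in> free_part (carrier G) A" using q' by (simp add: free_part_iff)
    then show ?thesis using dis unfolding disparse_iff_isolated[OF AG] by blast
  qed
  then obtain U where Uq: "\<And>q. q \<in> Z \<Longrightarrow> U q \<in> q"
    and U: "\<And>q g. q \<in> Z \<Longrightarrow> g \<in> carrier G \<Longrightarrow> U q \<in> translate_ultrafilter G g q \<Longrightarrow> g = \<one>"
    by metis
  have unique: "r = q" if q: "q \<in> Z" and r: "r \<in> Z" and Ur: "U q \<in> r" for q r
  proof (rule ccontr)
    assume "r \<noteq> q"
    have uq: "ultrafilter_on (carrier G) q" and ur: "ultrafilter_on (carrier G) r"
      using q r by (simp_all add: Z_def)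
    then obtain W where W: "W \<in> r" "W \<notin> q"
      using ultrafilter_subset_imp_eq[OF ur uq] \<open>r \<noteq> q\<close> by blast
    define V where "V = W \<inter> U q"
    have "V \<in> r" using ultrafilter_Int[OF ur W(1) Ur] V_def by simp
    have VG: "V \<subseteq> carrier G" by (rule ultrafilter_subset_carrier[OF ur \<open>V \<in> r\<close>])
    have "W \<subseteq> carrier G" by (rule ultrafilter_subset_carrier[OF ur W(1)])
    then have "V \<notin> q" using ultrafilter_superset[OF uq, of V W] W(2) V_def by blast
    have "carrier G - V \<notin> r" using ultrafilter_Diff_iff[OF ur VG] \<open>V \<in> r\<close> by simp
    then have "carrier G - V \<notin> ?\<Phi> q" using max[of q] q r by (auto simp: Z_def)
    \<comment> \<open>As the orbit of \<open>q\<close> is dense in \<open>Z\<close>, some translate of \<open>q\<close> lies near \<open>r\<close>, hence in the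
      neighbourhood \<open>U q\<close> of \<open>q\<close>.\<close>
    then obtain g where g: "g \<in> carrier G"
      and ng: "carrier G - V \<union> (carrier G - Y) \<notin> translate_ultrafilter G g q"
      by (auto simp: orbit_closure_family_def)
    have ug: "ultrafilter_on (carrier G) (translate_ultrafilter G g q)"
      by (rule ultrafilter_translate[OF uq g])
    have "carrier G - V \<union> (carrier G - Y) = carrier G - V \<inter> Y" by blast
    then have VY: "V \<inter> Y \<in> translate_ultrafilter G g q"
      using ng ultrafilter_Diff_iff[OF ug, of "V \<inter> Y"] VG by auto
    have "U q \<subseteq> carrier G" by (rule ultrafilter_subset_carrier[OF uq Uq[OF q]])
    then have "U q \<in> translate_ultrafilter G g q"
      using ultrafilter_superset[OF ug VY, of "U q"] V_def by blast
    then have "g = \<one>" by (rule U[OF q g])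
    then have "V \<inter> Y \<in> q" using VY translate_one[OF uq] by simp
    then show False using ultrafilter_superset[OF uq, of "V \<inter> Y" V] VG \<open>V \<notin> q\<close> by blast
  qed
  have "finite Z"
  proof (rule ccontr)
    assume "infinite Z"
    obtain q where q: "ultrafilter_on (carrier G) q" "?\<Phi> p \<union> (\<lambda>q. carrier G - U q) ` Z \<subseteq> q"
    proof (rule ultrafilter_extending)
      show "?\<Phi> p \<union> (\<lambda>q. carrier G - U q) ` Z \<subseteq> Pow (carrier G)"
        by (auto simp: orbit_closure_family_def)
      fix C assume C: "finite C" "C \<subseteq> ?\<Phi> p \<union> (\<lambda>q. carrier G - U q) ` Z"
      have "finite (C - ?\<Phi> p)" "C - ?\<Phi> p \<subseteq> (\<lambda>q. carrier G - U q) ` Z" using C by auto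
      from finite_subset_image[OF this]
      obtain Q where Q: "Q \<subseteq> Z" "finite Q" "C - ?\<Phi> p = (\<lambda>q. carrier G - U q) ` Q"
        by (elim exE conjE) (rule that)
      obtain r where r: "r \<in> Z" "r \<notin> Q" using \<open>infinite Z\<close> Q(2) by (meson finite_subset subsetI)
      have ur: "ultrafilter_on (carrier G) r" using r(1) by (simp add: Z_def)
      have "carrier G - U q \<in> r" if "q \<in> Q" for q
      proof -
        have qZ: "q \<in> Z" using that Q(1) by blast
        then have "U q \<notin> r" using unique[OF qZ r(1)] that r(2) by auto
        moreover have "U q \<subseteq> carrier G"
          using ultrafilter_subset_carrier[OF _ Uq[OF qZ]] qZ by (simp add: Z_def)
        ultimately show ?thesis using ultrafilter_Diff_iff[OF ur] by simp
      qed
      then have "C - ?\<Phi> p \<subseteq> r" unfolding Q(3) by blast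
      then have "C \<subseteq> r" using r(1) by (auto simp: Z_def)
      then show "carrier G \<inter> \<Inter>C \<noteq> {}"
        using ultrafilter_nonempty[OF ur ultrafilter_finite_Inter[OF ur C(1)]] by blast
    qed
    then have "q \<in> Z" by (simp add: Z_def)
    moreover from this have "U q \<subseteq> carrier G" "carrier G - U q \<in> q"
      using ultrafilter_subset_carrier[OF q(1) Uq] q(2) by auto
    ultimately show False using ultrafilter_Diff_iff[OF q(1), of "U q"] Uq by blast
  qed
  moreover have "ultracompanion G p Y \<subseteq> Z"
  proof
    fix r assume "r \<in> ultracompanion G p Y"
    then obtain g where "g \<in> carrier G" "r = translate_ultrafilter G g p"
      and "r \<in> free_part (carrier G) Y"
      unfolding ultracompanion_def ultrafilter_orbit_def by auto
    then show "r \<in> Z"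
      using orbit_closure_family_subset_translate[OF p] by (simp add: free_part_iff Z_def)
  qed
  ultimately show "\<exists>p\<in>free_part (carrier G) Y. finite (ultracompanion G p Y)"
    using p finite_subset by blast
qed

end

section \<open>Piecewise shifted IP-sets in sets that are not disparse\<close>

context group
begin

text \<open>The recursion chooses pairs of a member \<open>P\<close> of \<open>q\<close> and an element \<open>g \<noteq> \<one>\<close> with
  \<open>g\<^sup>-\<^sup>1 P \<in> q\<close>. The next \<open>P\<close> lies in \<open>P \<inter> g\<^sup>-\<^sup>1 P\<close>, which makes all products end in \<open>A\<close>, and it is
  taken so small that \<open>g\<close> can never be chosen again, which makes the sequence injective.\<close>

lemma not_disparse_imp_IP:
  assumes AG: "A \<subseteq> carrier G" and nd: "\<not> disparse G A"
  obtains S where "S \<subseteq> A" "is_piecewise_shifted_IP_set G S"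
proof -
  obtain q where q: "q \<in> free_part (carrier G) A"
    and rec: "\<And>U. U \<in> q \<Longrightarrow> \<exists>g\<in>carrier G. g \<noteq> \<one> \<and> U \<in> translate_ultrafilter G g q"
    using nd unfolding disparse_iff_isolated[OF AG] by blast
  have u: "ultrafilter_on (carrier G) q" and Aq: "A \<in> q" using q by (simp_all add: free_part_iff)
  define preshift where "preshift g U = {x \<in> carrier G. g \<otimes> x \<in> U}" for g U
  have preshift: "U \<in> translate_ultrafilter G g q \<longleftrightarrow> preshift g U \<in> q"
    if "g \<in> carrier G" "U \<in> q" for g U
    using mem_translate_ultrafilter[OF u that(1)] ultrafilter_subset_carrier[OF u that(2)]
    by (simp add: preshift_def)
  define inv_P where "inv_P s \<longleftrightarrow> fst s \<in> q \<and> fst s \<subseteq> A \<and> snd s \<in> carrier G \<and> snd s \<noteq> \<one> \<and>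
      preshift (snd s) (fst s) \<in> q" for s
  define step where "step s t \<longleftrightarrow> fst t \<subseteq> fst s \<inter> preshift (snd s) (fst s) \<and>
      preshift (snd s) (fst t) \<notin> q" for s t :: "'a set \<times> 'a"
  have "\<exists>f. \<forall>n. inv_P (f n) \<and> step (f n) (f (Suc n))"
  proof (rule dependent_nat_choice)
    obtain g where "g \<in> carrier G" "g \<noteq> \<one>" "A \<in> translate_ultrafilter G g q" using rec[OF Aq] by blast
    then show "\<exists>s. inv_P s" using Aq preshift unfolding inv_P_def by (intro exI[of _ "(A, g)"]) auto
  next
    fix s assume s: "inv_P s"
    obtain P g where [simp]: "s = (P, g)" by (cases s)
    have P: "P \<in> q" "P \<subseteq> A" and g: "g \<in> carrier G" "g \<noteq> \<one>" and gP: "preshift g P \<in> q"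
      using s by (simp_all add: inv_P_def)
    \<comment> \<open>A set \<open>W\<close> that separates \<open>q\<close> from its translate excludes \<open>g\<close> from all later choices.\<close>
    have "translate_ultrafilter G g q \<noteq> q" using translate_fixed_imp_one[OF u g(1)] g(2) by blast
    then obtain W where W: "W \<in> q" "W \<notin> translate_ultrafilter G g q"
      using ultrafilter_subset_imp_eq[OF u ultrafilter_translate[OF u g(1)]] by blast
    define P' where "P' = P \<inter> preshift g P \<inter> W"
    have P'q: "P' \<in> q" using ultrafilter_Int[OF u] P gP W(1) by (simp add: P'_def)
    have "P' \<notin> translate_ultrafilter G g q"
      using ultrafilter_superset[OF ultrafilter_translate[OF u g(1)], of P' W] W(2)
        ultrafilter_subset_carrier[OF u W(1)] by (auto simp: P'_def)
    moreover obtain g' where "g' \<in> carrier G" "g' \<noteq> \<one>" "P' \<in> translate_ultrafilter G g' q"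
      using rec[OF P'q] by blast
    ultimately show "\<exists>t. inv_P t \<and> step s t"
      using P P'q preshift[OF _ P'q] g(1)
      by (intro exI[of _ "(P', g')"]) (auto simp: inv_P_def step_def P'_def)
  qed
  then obtain f where "\<And>n. inv_P (f n)" and st: "\<And>n. step (f n) (f (Suc n))" by blast
  define P where "P n = fst (f n)" for n
  define g where "g n = snd (f n)" for n
  have Pq: "P n \<in> q" and PA: "P n \<subseteq> A" and gG: "g n \<in> carrier G" and gP: "preshift (g n) (P n) \<in> q" for n
    using \<open>inv_P (f n)\<close> by (simp_all add: inv_P_def P_def g_def)
  have P_Suc: "P (Suc n) \<subseteq> P n" "P (Suc n) \<subseteq> preshift (g n) (P n)" and out: "preshift (g n) (P (Suc n)) \<notin> q" for n
    using st[of n] by (auto simp: step_def P_def g_def)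
  have P_anti: "P j \<subseteq> P i" if "i \<le> j" for i j
    using lift_Suc_antimono_le[of P, OF P_Suc(1) that] .
  have "inj g"
  proof (rule linorder_injI)
    fix i j :: nat assume "i < j"
    then have "preshift (g j) (P j) \<subseteq> preshift (g j) (P (Suc i))"
      using P_anti[of "Suc i" j] by (auto simp: preshift_def)
    then have "preshift (g j) (P (Suc i)) \<in> q"
      using ultrafilter_superset[OF u gP[of j]] by (auto simp: preshift_def)
    then show "g i \<noteq> g j" using out[of i] by metis
  qed
  have "\<forall>n. \<exists>x. x \<in> P (Suc n)" using ultrafilter_nonempty[OF u Pq] by blast
  then obtain b where b: "\<And>n. b n \<in> P (Suc n)" by metis
  have "foldr (\<lambda>i x. g i \<otimes> x) js (b (last js)) \<in> P (hd js)"
    if "js \<noteq> []" "sorted_wrt (<) js" for js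
    using that
  proof (induction js rule: list_nonempty_induct)
    case (single j)
    then show ?case using b[of j] P_Suc(2)[of j] by (auto simp: preshift_def)
  next
    case (cons j js)
    then have "P (hd js) \<subseteq> P (Suc j)" by (intro P_anti) (cases js; auto)
    then show ?case using cons P_Suc(2)[of j] by (auto simp: preshift_def)
  qed
  then have "piecewise_shifted_IP_set G g b \<subseteq> A"
    using PA by (auto simp: piecewise_shifted_IP_set_def)
  moreover have "b n \<in> carrier G" for n
    using b[of n] PA[of "Suc n"] AG by auto
  then have "is_piecewise_shifted_IP_set G (piecewise_shifted_IP_set G g b)"
    unfolding is_piecewise_shifted_IP_set_def using \<open>inj g\<close> gG
    by (intro exI[of _ g] exI[of _ b]) auto
  ultimately show thesis by (rule that)
qed

end

section \<open>The direct sum of countably many groups of order two\<close>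

lemma Z2_sum_mult: "(u \<otimes>\<^bsub>Z2_sum\<^esub> v) i = (u i + v i) mod 2"
  by (simp add: Z2_sum_def)

lemma Z2_sum_one: "\<one>\<^bsub>Z2_sum\<^esub> = (\<lambda>_. 0)"
  by (simp add: Z2_sum_def restrict_def)

lemma carrier_Z2_sum_iff:
  "v \<in> carrier Z2_sum \<longleftrightarrow> (\<forall>i. v i = 0 \<or> v i = 1) \<and> finite {i. v i \<noteq> 0}"
proof -
  have "carrier (integer_mod_group 2) = {0, 1}"
    by (auto simp: carrier_integer_mod_group)
  then show ?thesis
    by (auto simp: Z2_sum_def carrier_sum_group PiE_def Pi_def)
qed

abbreviation (input) support :: "(nat \<Rightarrow> int) \<Rightarrow> nat set" where
  "support v \<equiv> {i. v i \<noteq> 0}"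

lemma Z2_sum_support_inj:
  assumes "v \<in> carrier Z2_sum" "w \<in> carrier Z2_sum" "support v = support w"
  shows "v = w"
proof
  fix i
  have "v i = 0 \<longleftrightarrow> w i = 0" using assms(3) by auto
  then show "v i = w i" using assms(1,2) unfolding carrier_Z2_sum_iff by metis
qed

lemma support_Z2_sum_mult:
  assumes "u \<in> carrier Z2_sum" "v \<in> carrier Z2_sum"
  shows "(u \<otimes>\<^bsub>Z2_sum\<^esub> v) i \<noteq> 0 \<longleftrightarrow> (u i \<noteq> 0) \<noteq> (v i \<noteq> 0)"
proof -
  have "u i = 0 \<or> u i = 1" "v i = 0 \<or> v i = 1" using assms unfolding carrier_Z2_sum_iff by auto
  then show ?thesis unfolding Z2_sum_mult by auto
qed

lemma indicator_in_Z2_sum: "finite I \<Longrightarrow> (\<lambda>i. if i \<in> I then 1 else 0) \<in> carrier Z2_sum"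
  by (auto simp: carrier_Z2_sum_iff)

lemma infinite_Z2_sum: "infinite (carrier Z2_sum)"
proof
  assume fin: "finite (carrier Z2_sum)"
  let ?e = "\<lambda>n i :: nat. if i \<in> {n} then 1 else 0 :: int"
  have "inj ?e" by (rule injI) (metis singletonI singletonD zero_neq_one)
  moreover have "range ?e \<subseteq> carrier Z2_sum" by (intro image_subsetI indicator_in_Z2_sum) simp
  then have "finite (range ?e)" by (rule finite_subset[OF _ fin])
  ultimately have "finite (UNIV :: nat set)" by (rule finite_imageD[rotated])
  then show False by simp
qed

lemma finite_Z2_sum_bounded: "finite {u \<in> carrier Z2_sum. support u \<subseteq> {..<n}}"
proof (rule finite_imageD)
  show "finite (support ` {u \<in> carrier Z2_sum. support u \<subseteq> {..<n}})"
    by (rule finite_subset[of _ "Pow {..<n}"]) auto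
  show "inj_on support {u \<in> carrier Z2_sum. support u \<subseteq> {..<n}}"
    using Z2_sum_support_inj by (auto intro!: inj_onI)
qed


section \<open>Asymorphisms\<close>

lemma prec_mapping_cong:
  assumes "\<And>x. x \<in> X \<Longrightarrow> f x = f' x"
  shows "prec_mapping G X H Y f \<longleftrightarrow> prec_mapping G X H Y f'"
proof -
  have "f ` coarse_ball G X x F = f' ` coarse_ball G X x F" for x F
    using assms by (intro image_cong) (auto simp: coarse_ball_def)
  moreover have "f \<in> X \<rightarrow> Y \<longleftrightarrow> f' \<in> X \<rightarrow> Y" unfolding Pi_iff using assms by simp
  ultimately show ?thesis using assms by (simp add: prec_mapping_def)
qed

lemma asymorphism_inv_into:
  assumes "asymorphism G X H Y f"
  shows "asymorphism H Y G X (inv_into X f)"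
proof -
  have bij: "bij_betw f X Y" using assms by (simp add: asymorphism_def)
  then have "inv_into Y (inv_into X f) x = f x" if "x \<in> X" for x
    using that by (simp add: inv_into_inv_into_eq)
  then have "prec_mapping G X H Y (inv_into Y (inv_into X f)) \<longleftrightarrow> prec_mapping G X H Y f"
    by (rule prec_mapping_cong)
  then show ?thesis
    using assms bij_betw_inv_into[OF bij] by (simp add: asymorphism_def)
qed


section \<open>Thin sequences and their finite products\<close>

context group
begin

primrec subproduct :: "(nat \<Rightarrow> 'a) \<Rightarrow> nat set \<Rightarrow> nat \<Rightarrow> 'a" where
  "subproduct g I 0 = \<one>"
| "subproduct g I (Suc n) = (if n \<in> I then subproduct g I n \<otimes> g n else subproduct g I n)"

definition branch_point :: "(nat \<Rightarrow> 'a) \<Rightarrow> (nat \<Rightarrow> 'a) \<Rightarrow> nat set \<Rightarrow> 'a" where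
  "branch_point g c I = subproduct g I (Max I) \<otimes> c (Max I)"

lemma subproduct_closed: "(\<And>n. g n \<in> carrier G) \<Longrightarrow> subproduct g I n \<in> carrier G"
  by (induction n) auto

lemma branch_point_closed:
  "(\<And>n. g n \<in> carrier G) \<Longrightarrow> (\<And>n. c n \<in> carrier G) \<Longrightarrow> branch_point g c I \<in> carrier G"
  by (simp add: branch_point_def subproduct_closed)

lemma subproduct_mult_eq_foldr:
  assumes "\<And>n. g n \<in> carrier G" "z \<in> carrier G"
  shows "subproduct g I n \<otimes> z = foldr (\<lambda>i x. g i \<otimes> x) (filter (\<lambda>i. i \<in> I) [0..<n]) z"
  using assms(2)
proof (induction n arbitrary: z)
  case (Suc n)
  show ?case
    using Suc.IH[of "g n \<otimes> z"] Suc.IH[of z] Suc.prems assms(1) subproduct_closed[of g I n]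
    by (cases "n \<in> I") (simp_all add: m_assoc)
qed simp

end

text \<open>The products of the \<open>g i\<close> over index sets contained in \<open>{..<n}\<close> lie in \<open>F n\<close>, and the points
  \<open>g i\<^sub>1 \<cdots> g i\<^sub>k c j\<close> with \<open>i\<^sub>1 < \<dots> < i\<^sub>k < j < n\<close> lie in \<open>Y n\<close>. The finite set \<open>W n\<close> holds the
  quotients of two points whose index sets agree from \<open>n\<close> on. Thinness is the requirement that the quotients arising at level \<open>n\<close> are new, that is, outside \<open>W n\<close>. The sequence
  \<open>c\<close> consists of the last two factors \<open>g n b n\<close> of the points. It is kept separate because it may
  be constant although \<open>g\<close> is injective, and it has to avoid old quotients as well.\<close>

locale thin_sequences = group +
  fixes g c :: "nat \<Rightarrow> 'a" and F Y W :: "nat \<Rightarrow> 'a set"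
  assumes g_closed: "g n \<in> carrier G" and c_closed: "c n \<in> carrier G"
    and F_0: "\<one> \<in> F 0" and F_mono: "F n \<subseteq> F (Suc n)"
    and F_Suc: "a \<in> F n \<Longrightarrow> a \<otimes> g n \<in> F (Suc n)"
    and Y_mono: "Y n \<subseteq> Y (Suc n)" and Y_Suc: "a \<in> F n \<Longrightarrow> a \<otimes> c n \<in> Y (Suc n)"
    and W_finite: "finite (W n)" and W_closed: "W n \<subseteq> carrier G"
    and W_mono: "W n \<subseteq> W (Suc n)" and W_inv: "w \<in> W n \<Longrightarrow> inv w \<in> W n" and W_0: "\<one> \<in> W 0"
    and new_g: "a \<in> F n \<Longrightarrow> a' \<in> F n \<Longrightarrow> a \<otimes> g n \<otimes> inv a' \<in> W (Suc n) - W n"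
    and new_c: "a \<in> F n \<Longrightarrow> y \<in> Y n \<Longrightarrow> a \<otimes> c n \<otimes> inv y \<in> W (Suc n) - W n"
begin

lemma W_le: "m \<le> n \<Longrightarrow> W m \<subseteq> W n"
  using lift_Suc_mono_le[of W, OF W_mono] .

lemma one_in_W: "\<one> \<in> W n"
  using W_le[of 0 n] W_0 by auto

lemma subproduct_mem: "subproduct g I n \<in> F n"
proof (induction n)
  case (Suc n)
  then show ?case using F_mono F_Suc by auto
qed (simp add: F_0)

lemma branch_point_mem:
  assumes "finite I" "I \<noteq> {}" "I \<subseteq> {..<n}"
  shows "branch_point g c I \<in> Y n"
proof -
  have "Suc (Max I) \<le> n" using Max_in[OF assms(1,2)] assms(3) by auto
  then have "Y (Suc (Max I)) \<subseteq> Y n" using lift_Suc_mono_le[of Y, OF Y_mono] by blast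
  moreover have "branch_point g c I \<in> Y (Suc (Max I))"
    unfolding branch_point_def using Y_Suc subproduct_mem by blast
  ultimately show ?thesis by blast
qed

text \<open>Factors on the right that occur in both products cancel in the quotient.\<close>

lemma subproduct_common_tail:
  assumes "m \<le> n" "\<And>i. m \<le> i \<Longrightarrow> i \<in> I \<longleftrightarrow> i \<in> J"
  shows "subproduct g I n \<otimes> inv (subproduct g J n) = subproduct g I m \<otimes> inv (subproduct g J m)"
  using assms(1)
proof (induction n rule: dec_induct)
  case (step n)
  note cl = subproduct_closed[of g, OF g_closed]
  have "a \<otimes> g n \<otimes> inv (b \<otimes> g n) = a \<otimes> inv b" if "a \<in> carrier G" "b \<in> carrier G" for a b
    using that g_closed[of n] by (simp add: inv_mult_group m_assoc) (simp add: m_assoc[symmetric])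
  then show ?case using step assms(2)[of n] cl by simp
qed simp

text \<open>The highest level \<open>m\<close> at which \<open>I\<close> and \<open>J\<close> differ can be read off from the quotient of their
  points. If \<open>J\<close> goes beyond \<open>m\<close>, then so does \<open>I\<close>, with the same maximum, and cancelling the
  common tail leaves a quotient with \<open>g m\<close> in the middle. Otherwise the point of \<open>I\<close> ends with
  \<open>c m\<close>, and the point of \<open>J\<close> is formed from indices below \<open>m\<close>.\<close>

lemma branch_point_difference_aux:
  assumes I: "finite I" "I \<noteq> {}" and J: "finite J" "J \<noteq> {}"
    and m: "m \<in> I" "m \<notin> J" and agree: "\<And>i. m < i \<Longrightarrow> i \<in> I \<longleftrightarrow> i \<in> J"
  shows "branch_point g c I \<otimes> inv (branch_point g c J) \<in> W (Suc m) - W m"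
proof (cases "m < Max J")
  case True
  have MI: "Max I = Max J"
  proof (rule Max_eqI)
    show "Max J \<in> I" using agree[OF True] Max_in[OF J] by blast
    show "i \<le> Max J" if "i \<in> I" for i
      using that agree[of i] True Max_ge[OF J(1), of i] by (cases "m < i") auto
  qed fact
  have "branch_point g c I \<otimes> inv (branch_point g c J)
      = subproduct g I (Max J) \<otimes> inv (subproduct g J (Max J))"
    using subproduct_closed[of g, OF g_closed] c_closed[of "Max J"] unfolding branch_point_def MI
    by (simp add: inv_mult_group m_assoc) (simp add: m_assoc[symmetric])
  also have "\<dots> = subproduct g I (Suc m) \<otimes> inv (subproduct g J (Suc m))"
    using True agree by (intro subproduct_common_tail) auto
  also have "\<dots> = subproduct g I m \<otimes> g m \<otimes> inv (subproduct g J m)" using m by simp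
  finally show ?thesis using new_g[OF subproduct_mem subproduct_mem] by simp
next
  case False
  have "i < m" if "i \<in> J" for i
  proof -
    have "i \<le> Max J" using Max_ge[OF J(1) that] .
    moreover have "i \<noteq> m" using that m(2) by blast
    ultimately show ?thesis using False by simp
  qed
  then have "branch_point g c J \<in> Y m" using branch_point_mem[OF J] by blast
  moreover have "Max I = m"
  proof (rule Max_eqI)
    show "i \<le> m" if "i \<in> I" for i
      using that agree[of i] \<open>\<And>i. i \<in> J \<Longrightarrow> i < m\<close>[of i] by (cases "m < i") auto
  qed fact+
  ultimately show ?thesis using new_c[OF subproduct_mem] by (simp add: branch_point_def)
qed

lemma branch_point_difference:
  assumes I: "finite I" "I \<noteq> {}" and J: "finite J" "J \<noteq> {}" and "I \<noteq> J"
  obtains m where "m \<in> I \<longleftrightarrow> m \<notin> J" "\<And>i. m < i \<Longrightarrow> i \<in> I \<longleftrightarrow> i \<in> J"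
    and "branch_point g c I \<otimes> inv (branch_point g c J) \<in> W (Suc m) - W m"
proof -
  define m where "m = Max ((I - J) \<union> (J - I))"
  have fin: "finite ((I - J) \<union> (J - I))" using I J by blast
  have "m \<in> (I - J) \<union> (J - I)" unfolding m_def by (rule Max_in[OF fin]) (use \<open>I \<noteq> J\<close> in blast)
  then have m: "m \<in> I \<longleftrightarrow> m \<notin> J" by blast
  have agree: "i \<in> I \<longleftrightarrow> i \<in> J" if "m < i" for i
    using Max_ge[OF fin, of i] that unfolding m_def[symmetric] by auto
  note cl = branch_point_closed[of g c, OF g_closed c_closed]
  show thesis
  proof (cases "m \<in> I")
    case True
    then show thesis using that m agree branch_point_difference_aux[OF I J _ _ agree] by blast
  next
    case False
    have *: "branch_point g c J \<otimes> inv (branch_point g c I) \<in> W (Suc m) - W m"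
      using branch_point_difference_aux[OF J I _ _ agree[symmetric]] m False by blast
    have eq: "branch_point g c I \<otimes> inv (branch_point g c J)
        = inv (branch_point g c J \<otimes> inv (branch_point g c I))"
      using cl by (simp add: inv_mult_group)
    have "inv (branch_point g c J \<otimes> inv (branch_point g c I)) \<in> W (Suc m) - W m"
      using * W_inv W_inv[of "inv (branch_point g c J \<otimes> inv (branch_point g c I))" m] cl by auto
    then show thesis using that m agree unfolding eq by blast
  qed
qed

text \<open>The zero vector has to be left out, as its support has no largest element. The nonzero vectors
  are still large in \<open>\<Oplus>\<^sub>\<omega> \<int>\<^sub>2\<close>, since zero is \<open>e + e\<close> for a unit vector \<open>e\<close>.\<close>

definition nonzero :: "(nat \<Rightarrow> int) set" where
  "nonzero = carrier Z2_sum - {\<one>\<^bsub>Z2_sum\<^esub>}"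

definition ip_point :: "(nat \<Rightarrow> int) \<Rightarrow> 'a" where
  "ip_point v = branch_point g c (support v)"

lemma nonzero_support:
  "v \<in> nonzero \<Longrightarrow> v \<in> carrier Z2_sum \<and> finite (support v) \<and> support v \<noteq> {}"
  by (auto simp: nonzero_def Z2_sum_one carrier_Z2_sum_iff)

lemma ip_point_closed: "ip_point v \<in> carrier G"
  unfolding ip_point_def using branch_point_closed g_closed c_closed by blast

lemma ip_point_difference:
  assumes v: "v \<in> nonzero" and w: "w \<in> nonzero" and "v \<noteq> w"
  obtains m where "(v m \<noteq> 0) \<noteq> (w m \<noteq> 0)" "\<And>i. m < i \<Longrightarrow> v i \<noteq> 0 \<longleftrightarrow> w i \<noteq> 0"
    and "ip_point v \<otimes> inv (ip_point w) \<in> W (Suc m) - W m"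
proof -
  have sv: "finite (support v)" "support v \<noteq> {}" and sw: "finite (support w)" "support w \<noteq> {}"
    using nonzero_support v w by auto
  have ne: "support v \<noteq> support w"
    using Z2_sum_support_inj \<open>v \<noteq> w\<close> nonzero_support[OF v] nonzero_support[OF w] by blast
  obtain m where "m \<in> support v \<longleftrightarrow> m \<notin> support w"
    and "\<And>i. m < i \<Longrightarrow> i \<in> support v \<longleftrightarrow> i \<in> support w"
    and "branch_point g c (support v) \<otimes> inv (branch_point g c (support w)) \<in> W (Suc m) - W m"
    by (rule branch_point_difference[OF sv sw ne]) (rule that)
  then show thesis by (intro that[of m]) (simp_all add: ip_point_def)
qed

lemma inj_on_ip_point: "inj_on ip_point nonzero"
proof (rule inj_onI, rule ccontr)
  fix v w assume "v \<in> nonzero" "w \<in> nonzero" "ip_point v = ip_point w" "v \<noteq> w"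
  then obtain m where "ip_point v \<otimes> inv (ip_point v) \<notin> W m"
    using ip_point_difference[of v w] by (metis DiffD2)
  then show False using one_in_W ip_point_closed by simp
qed

text \<open>Vectors that differ by an element of a finite set \<open>K\<close> have supports that agree above a bound
  \<open>n\<close> depending on \<open>K\<close> only, so the quotient of their points lies in \<open>W n\<close>.\<close>

lemma prec_mapping_ip_point: "prec_mapping Z2_sum nonzero G (ip_point ` nonzero) ip_point"
  unfolding prec_mapping_def
proof (intro conjI allI impI)
  fix K assume K: "finite K \<and> K \<subseteq> carrier Z2_sum"
  have "finite (\<Union>k\<in>K. support k)" using K by (auto simp: carrier_Z2_sum_iff)
  then obtain n where n: "(\<Union>k\<in>K. support k) \<subseteq> {..<n}"
    using finite_nat_iff_bounded by blast
  have "ip_point ` coarse_ball Z2_sum nonzero v K \<subseteq> coarse_ball G (ip_point ` nonzero) (ip_point v) (W n)"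
    if v: "v \<in> nonzero" for v
  proof (rule image_subsetI)
    fix w assume w: "w \<in> coarse_ball Z2_sum nonzero v K"
    then have "w \<in> nonzero" by (simp add: coarse_ball_iff)
    moreover have "ip_point w = ip_point v \<or> (\<exists>h\<in>W n. ip_point w = h \<otimes> ip_point v)"
    proof (cases "w = v")
      case False
      then obtain k where k: "k \<in> K" "w = k \<otimes>\<^bsub>Z2_sum\<^esub> v" using w unfolding coarse_ball_iff by auto
      obtain m where m: "(w m \<noteq> 0) \<noteq> (v m \<noteq> 0)" "\<And>i. m < i \<Longrightarrow> w i \<noteq> 0 \<longleftrightarrow> v i \<noteq> 0"
        "ip_point w \<otimes> inv (ip_point v) \<in> W (Suc m) - W m"
        by (rule ip_point_difference[OF \<open>w \<in> nonzero\<close> v False]) (rule that)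
      have "k m \<noteq> 0"
        using m(1) support_Z2_sum_mult[of k v m] k K nonzero_support[OF v] by auto
      then have "Suc m \<le> n" using n k(1) by auto
      then have "ip_point w \<otimes> inv (ip_point v) \<in> W n" using m(3) W_le[of "Suc m" n] by blast
      moreover have "ip_point w = ip_point w \<otimes> inv (ip_point v) \<otimes> ip_point v"
        using ip_point_closed by (simp add: m_assoc)
      ultimately show ?thesis by blast
    qed simp
    ultimately show "ip_point w \<in> coarse_ball G (ip_point ` nonzero) (ip_point v) (W n)"
      unfolding coarse_ball_iff by blast
  qed
  then show "\<exists>F. finite F \<and> F \<subseteq> carrier G \<and> (\<forall>v\<in>nonzero.
      ip_point ` coarse_ball Z2_sum nonzero v K \<subseteq> coarse_ball G (ip_point ` nonzero) (ip_point v) F)"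
    by (intro exI[of _ "W n"]) (simp add: W_finite W_closed)
qed auto

text \<open>Here thinness enters: the quotients that belong to a finite set \<open>F\<close> have all appeared in
  \<open>W n\<close> for some \<open>n\<close>, and later levels produce new quotients only. Hence points whose quotient
  lies in \<open>F\<close> come from vectors that agree from \<open>n\<close> on.\<close>

lemma prec_mapping_ip_point_inv:
  "prec_mapping G (ip_point ` nonzero) Z2_sum nonzero (inv_into nonzero ip_point)"
  unfolding prec_mapping_def
proof (intro conjI allI impI)
  show "inv_into nonzero ip_point \<in> ip_point ` nonzero \<rightarrow> nonzero" by (auto intro: inv_into_into)
  fix F assume F: "finite F \<and> F \<subseteq> carrier G"
  have "\<exists>n. \<forall>h\<in>F. \<forall>m. h \<in> W m \<longrightarrow> h \<in> W n"
  proof -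
    have "\<forall>h\<in>F. \<exists>n. \<forall>m. h \<in> W m \<longrightarrow> h \<in> W n" by blast
    from bchoice[OF this] obtain N where N: "\<And>h m. h \<in> F \<Longrightarrow> h \<in> W m \<Longrightarrow> h \<in> W (N h)"
      by blast
    have "h \<in> W (Max (N ` F))" if "h \<in> F" "h \<in> W m" for h m
      using N[OF that] W_le[of "N h" "Max (N ` F)"] F that(1) by auto
    then show ?thesis by blast
  qed
  then obtain n where n: "\<And>h m. h \<in> F \<Longrightarrow> h \<in> W m \<Longrightarrow> h \<in> W n" by blast
  define K where "K = {u \<in> carrier Z2_sum. support u \<subseteq> {..<n}}"
  have "inv_into nonzero ip_point ` coarse_ball G (ip_point ` nonzero) x F
      \<subseteq> coarse_ball Z2_sum nonzero (inv_into nonzero ip_point x) K" if x: "x \<in> ip_point ` nonzero" for x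
  proof (rule image_subsetI)
    fix z assume z: "z \<in> coarse_ball G (ip_point ` nonzero) x F"
    obtain v where v: "v \<in> nonzero" "x = ip_point v" using x by blast
    obtain w where w: "w \<in> nonzero" "z = ip_point w" using z unfolding coarse_ball_iff by blast
    have "w = v \<or> (\<exists>k\<in>K. w = k \<otimes>\<^bsub>Z2_sum\<^esub> v)"
    proof (cases "w = v")
      case False
      then have "ip_point w \<noteq> ip_point v" using inj_on_ip_point v w by (auto dest: inj_onD)
      then obtain h where h: "h \<in> F" "ip_point w = h \<otimes> ip_point v"
        using z v w unfolding coarse_ball_iff by auto
      obtain m where m: "(w m \<noteq> 0) \<noteq> (v m \<noteq> 0)" "\<And>i. m < i \<Longrightarrow> w i \<noteq> 0 \<longleftrightarrow> v i \<noteq> 0"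
        "ip_point w \<otimes> inv (ip_point v) \<in> W (Suc m) - W m"
        by (rule ip_point_difference[OF w(1) v(1) False]) (rule that)
      have "h = ip_point w \<otimes> inv (ip_point v)"
        using h F ip_point_closed[of v] by (auto simp: m_assoc)
      then have "h \<in> W n" "h \<notin> W m" using n[OF h(1)] m(3) by auto
      then have "m < n" using W_le[of n m] by (meson leI subsetD)
      define k where "k = w \<otimes>\<^bsub>Z2_sum\<^esub> v"
      interpret Z2: group Z2_sum by (rule group_Z2_sum)
      have wv: "w \<in> carrier Z2_sum" "v \<in> carrier Z2_sum" using nonzero_support v w by blast+
      then have kc: "k \<in> carrier Z2_sum" by (simp add: k_def)
      have "i < n" if "k i \<noteq> 0" for i
      proof (rule ccontr)
        assume "\<not> i < n"
        then have "m < i" using \<open>m < n\<close> by simp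
        then show False using m(2)[of i] that support_Z2_sum_mult[OF wv, of i] by (simp add: k_def)
      qed
      then have "k \<in> K" using kc by (auto simp: K_def)
      moreover have "w = k \<otimes>\<^bsub>Z2_sum\<^esub> v"
      proof (rule Z2_sum_support_inj)
        show "support w = support (k \<otimes>\<^bsub>Z2_sum\<^esub> v)"
          using support_Z2_sum_mult[OF kc wv(2)] support_Z2_sum_mult[OF wv] by (auto simp: k_def)
      qed (use wv kc in auto)
      ultimately show ?thesis by blast
    qed simp
    moreover have "inv_into nonzero ip_point x = v" "inv_into nonzero ip_point z = w"
      using v w inj_on_ip_point by simp_all
    ultimately show "inv_into nonzero ip_point z \<in> coarse_ball Z2_sum nonzero (inv_into nonzero ip_point x) K"
      using w(1) unfolding coarse_ball_iff by simp
  qed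
  moreover have "finite K" "K \<subseteq> carrier Z2_sum"
    unfolding K_def using finite_Z2_sum_bounded by auto
  ultimately show "\<exists>K. finite K \<and> K \<subseteq> carrier Z2_sum \<and> (\<forall>x\<in>ip_point ` nonzero.
      inv_into nonzero ip_point ` coarse_ball G (ip_point ` nonzero) x F
        \<subseteq> coarse_ball Z2_sum nonzero (inv_into nonzero ip_point x) K)" by blast
qed

lemma coarsely_equivalent_ip_point: "coarsely_equivalent G (ip_point ` nonzero) Z2_sum (carrier Z2_sum)"
proof -
  have "asymorphism Z2_sum nonzero G (ip_point ` nonzero) ip_point"
    using prec_mapping_ip_point prec_mapping_ip_point_inv inj_on_ip_point
    by (simp add: asymorphism_def inj_on_imp_bij_betw)
  then have "asymorphic G (ip_point ` nonzero) Z2_sum nonzero"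
    unfolding asymorphic_def using asymorphism_inv_into by blast
  have "ip_point ` nonzero \<subseteq> coarse_nbhd G (ip_point ` nonzero) (ip_point ` nonzero) {}"
    unfolding coarse_nbhd_def coarse_ball_iff by (auto simp: coarse_ball_iff)
  define e :: "nat \<Rightarrow> int" where "e = (\<lambda>i. if i \<in> {0} then 1 else 0)"
  have e: "e \<in> carrier Z2_sum" unfolding e_def by (rule indicator_in_Z2_sum) simp
  have "e \<noteq> \<one>\<^bsub>Z2_sum\<^esub>" unfolding e_def Z2_sum_one by (auto dest: fun_cong[of _ _ 0])
  then have e': "e \<in> nonzero" using e by (simp add: nonzero_def)
  have ee: "e \<otimes>\<^bsub>Z2_sum\<^esub> e = \<one>\<^bsub>Z2_sum\<^esub>"
    unfolding e_def by (rule ext) (simp add: Z2_sum_mult Z2_sum_one)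
  have large: "carrier Z2_sum \<subseteq> coarse_nbhd Z2_sum (carrier Z2_sum) nonzero {e}"
  proof
    fix v assume v: "v \<in> carrier Z2_sum"
    show "v \<in> coarse_nbhd Z2_sum (carrier Z2_sum) nonzero {e}"
    proof (cases "v = \<one>\<^bsub>Z2_sum\<^esub>")
      case True
      then have "v \<in> coarse_ball Z2_sum (carrier Z2_sum) e {e}"
        using v ee by (simp add: coarse_ball_iff)
      then show ?thesis unfolding coarse_nbhd_def using e' by blast
    next
      case False
      then have "v \<in> coarse_ball Z2_sum (carrier Z2_sum) v {e}" "v \<in> nonzero"
        using v by (simp_all add: coarse_ball_iff nonzero_def)
      then show ?thesis unfolding coarse_nbhd_def by blast
    qed
  qed
  have sub: "nonzero \<subseteq> carrier Z2_sum" by (auto simp: nonzero_def)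
  show ?thesis
    unfolding coarsely_equivalent_def
  proof (intro exI conjI)
    show "asymorphic G (ip_point ` nonzero) Z2_sum nonzero" by fact
    show "ip_point ` nonzero \<subseteq> coarse_nbhd G (ip_point ` nonzero) (ip_point ` nonzero) {}" by fact
    show "carrier Z2_sum \<subseteq> coarse_nbhd Z2_sum (carrier Z2_sum) nonzero {e}" by fact
  qed (use e sub in simp_all)
qed

end

section \<open>Thinning out a piecewise shifted IP-set\<close>

context group
begin

lemma sandwich_inj:
  assumes "a \<in> carrier G" "b \<in> carrier G" "x \<in> carrier G" "a \<otimes> x \<otimes> inv b = w"
  shows "x = inv a \<otimes> w \<otimes> b"
  using assms by (auto simp: m_assoc) (simp add: m_assoc[symmetric])

text \<open>Each of the finitely many forbidden equations determines \<open>g i\<close>, or \<open>g i \<otimes> (g k \<otimes> b k)\<close>, so that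
  these two elements only have to avoid a finite set \<open>bad\<close>. The element \<open>g i \<otimes> b i\<close> may be the same
  for all \<open>i\<close>, hence the last factor is taken from a later index \<open>k\<close>: for fixed \<open>k\<close>, the elements
  \<open>g i \<otimes> (g k \<otimes> b k)\<close> with \<open>i < k\<close> are distinct, and if there are more of them than forbidden
  elements, one is admissible.\<close>

lemma thinning_step:
  fixes g b :: "nat \<Rightarrow> 'a"
  assumes g: "\<And>n. g n \<in> carrier G" and "inj g" and b: "\<And>n. b n \<in> carrier G"
    and "finite F" "finite Y" "finite W" and FG: "F \<subseteq> carrier G" and YG: "Y \<subseteq> carrier G"
  obtains i k where "N < i" "i < k"
    and "\<And>a a'. a \<in> F \<Longrightarrow> a' \<in> F \<Longrightarrow> a \<otimes> g i \<otimes> inv a' \<notin> W"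
    and "\<And>a y. a \<in> F \<Longrightarrow> y \<in> Y \<Longrightarrow> a \<otimes> (g i \<otimes> (g k \<otimes> b k)) \<otimes> inv y \<notin> W"
proof -
  define bad where "bad = (\<lambda>(a, w, d). inv a \<otimes> w \<otimes> d) ` (F \<times> W \<times> (F \<union> Y))"
  have "finite bad" using assms by (simp add: bad_def)
  have good: "a \<otimes> x \<otimes> inv d \<notin> W"
    if x: "x \<in> carrier G" "x \<notin> bad" and a: "a \<in> F" and d: "d \<in> F \<union> Y" for x a d
  proof
    assume "a \<otimes> x \<otimes> inv d \<in> W"
    moreover have "x = inv a \<otimes> (a \<otimes> x \<otimes> inv d) \<otimes> d"
      using sandwich_inj[of a d x] a d x FG YG by auto
    ultimately have "x \<in> bad" unfolding bad_def using a d by force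
    then show False using x by blast
  qed
  have "finite (g -` bad)" using \<open>finite bad\<close> \<open>inj g\<close> by (rule finite_vimageI)
  then have "infinite ({N<..} - g -` bad)" by (simp add: infinite_Ioi)
  from infinite_arbitrarily_large[OF this, of "Suc (card bad)"]
  obtain M where M: "finite M" "card M = Suc (card bad)" "M \<subseteq> {N<..} - g -` bad"
    by blast
  then obtain k where k: "M \<subseteq> {..<k}" using finite_nat_iff_bounded by blast
  have "inj_on (\<lambda>i. g i \<otimes> (g k \<otimes> b k)) M"
    using \<open>inj g\<close> g b by (auto simp: inj_on_def)
  then have "card ((\<lambda>i. g i \<otimes> (g k \<otimes> b k)) ` M) = Suc (card bad)"
    using M(2) by (simp add: card_image)
  then have "\<not> (\<lambda>i. g i \<otimes> (g k \<otimes> b k)) ` M \<subseteq> bad"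
    using card_mono[OF \<open>finite bad\<close>, of "(\<lambda>i. g i \<otimes> (g k \<otimes> b k)) ` M"] by auto
  then obtain i where i: "i \<in> M" "g i \<otimes> (g k \<otimes> b k) \<notin> bad" by blast
  show thesis
  proof (rule that[of i k])
    show "N < i" "i < k" using i(1) M(3) k by auto
    show "a \<otimes> g i \<otimes> inv a' \<notin> W" if "a \<in> F" "a' \<in> F" for a a'
      using good[of "g i"] that i(1) M(3) g by auto
    show "a \<otimes> (g i \<otimes> (g k \<otimes> b k)) \<otimes> inv y \<notin> W" if "a \<in> F" "y \<in> Y" for a y
      using good[of "g i \<otimes> (g k \<otimes> b k)"] that i(2) g b by auto
  qed
qed

text \<open>Iterating the previous step. The chosen indices interleave as \<open>\<mu> 0 < \<kappa> 0 < \<mu> 1 < \<kappa> 1 < \<dots>\<close>, so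
  that products of the new sequences are products over increasing indices in the old ones.\<close>

lemma thin_subsequence:
  fixes g b :: "nat \<Rightarrow> 'a"
  assumes g: "\<And>n. g n \<in> carrier G" and "inj g" and b: "\<And>n. b n \<in> carrier G"
  obtains \<mu> \<kappa> F Y W where "\<And>n. \<mu> n < \<kappa> n" "\<And>n. \<kappa> n < \<mu> (Suc n)"
    and "thin_sequences G (\<lambda>n. g (\<mu> n)) (\<lambda>n. g (\<mu> n) \<otimes> (g (\<kappa> n) \<otimes> b (\<kappa> n))) F Y W"
proof -
  define x where "x i k = g i \<otimes> (g k \<otimes> b k)" for i k
  have x: "x i k \<in> carrier G" for i k using g b by (simp add: x_def)
  define fresh where "fresh F Y i k = (\<lambda>(a, a'). a \<otimes> g i \<otimes> inv a') ` (F \<times> F)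
      \<union> (\<lambda>(a, y). a \<otimes> x i k \<otimes> inv y) ` (F \<times> Y)" for F Y i k
  \<comment> \<open>A state consists of the current indices and of the sets \<open>F\<close>, \<open>Y\<close>, \<open>W\<close> before their use; its
    \<open>fresh\<close> quotients are those which the current indices add.\<close>
  define ok where "ok = (\<lambda>(i, k, F, Y, W). i < k \<and> finite F \<and> finite Y \<and> finite W \<and>
      F \<subseteq> carrier G \<and> Y \<subseteq> carrier G \<and> W \<subseteq> carrier G \<and> \<one> \<in> F \<and> \<one> \<in> W \<and> (\<forall>w\<in>W. inv w \<in> W) \<and>
      fresh F Y i k \<inter> W = {})"
  define step where "step = (\<lambda>(i, k, F, Y, W) (i', k' :: nat, F', Y', W'). k < i' \<and>
      F' = F \<union> (\<lambda>a. a \<otimes> g i) ` F \<and> Y' = Y \<union> (\<lambda>a. a \<otimes> x i k) ` F \<and>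
      W' = W \<union> fresh F Y i k \<union> m_inv G ` fresh F Y i k)"
  have next_indices: "\<exists>i k. N < i \<and> i < k \<and> fresh F Y i k \<inter> W = {}"
    if fin: "finite F" "finite Y" "finite W" and FG: "F \<subseteq> carrier G" "Y \<subseteq> carrier G" for N F Y W
  proof -
    obtain i k where "N < i" "i < k"
      and *: "\<And>a a'. a \<in> F \<Longrightarrow> a' \<in> F \<Longrightarrow> a \<otimes> g i \<otimes> inv a' \<notin> W"
        "\<And>a y. a \<in> F \<Longrightarrow> y \<in> Y \<Longrightarrow> a \<otimes> (g i \<otimes> (g k \<otimes> b k)) \<otimes> inv y \<notin> W"
      by (rule thinning_step[where g = g and b = b, OF g \<open>inj g\<close> b fin FG]) (rule that)
    then have "fresh F Y i k \<inter> W = {}" by (auto simp: fresh_def x_def)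
    then show ?thesis using \<open>N < i\<close> \<open>i < k\<close> by blast
  qed
  have "\<exists>f. \<forall>n. ok (f n) \<and> step (f n) (f (Suc n))"
  proof (rule dependent_nat_choice)
    obtain i k where "0 < i" "i < k" "fresh {\<one>} {} i k \<inter> {\<one>} = {}"
      using next_indices[of "{\<one>}" "{}" "{\<one>}" 0] by auto
    then show "\<exists>s. ok s"
      by (intro exI[of _ "(i, k, {\<one>}, {}, {\<one>})"]) (simp add: ok_def)
  next
    fix s assume s: "ok s"
    obtain i k F Y W where [simp]: "s = (i, k, F, Y, W)" by (cases s)
    have ok: "i < k" "finite F" "finite Y" "finite W" "F \<subseteq> carrier G" "Y \<subseteq> carrier G" "W \<subseteq> carrier G"
      "\<one> \<in> F" "\<one> \<in> W" "\<And>w. w \<in> W \<Longrightarrow> inv w \<in> W"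
      using s by (simp_all add: ok_def)
    define F' where "F' = F \<union> (\<lambda>a. a \<otimes> g i) ` F"
    define Y' where "Y' = Y \<union> (\<lambda>a. a \<otimes> x i k) ` F"
    define W' where "W' = W \<union> fresh F Y i k \<union> m_inv G ` fresh F Y i k"
    have fr: "fresh F Y i k \<subseteq> carrier G"
      using ok(5,6) g x by (auto simp: fresh_def subset_iff)
    have "finite (fresh F Y i k)" using ok(2,3) by (simp add: fresh_def)
    then have F': "finite F'" "F' \<subseteq> carrier G" and Y': "finite Y'" "Y' \<subseteq> carrier G"
      and W': "finite W'" "W' \<subseteq> carrier G"
      using ok(2-7) g x fr by (auto simp: F'_def Y'_def W'_def)
    obtain i' k' where i': "k < i'" "i' < k'" "fresh F' Y' i' k' \<inter> W' = {}"
      using next_indices[OF F'(1) Y'(1) W'(1) F'(2) Y'(2), of k] by blast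
    have "inv w \<in> W'" if w: "w \<in> W'" for w
    proof -
      consider "w \<in> W" | "w \<in> fresh F Y i k" | v where "v \<in> fresh F Y i k" "w = inv v"
        using w by (auto simp: W'_def)
      then show ?thesis
      proof cases
        case 3
        then have "inv w = v" using fr by auto
        then show ?thesis using 3 by (simp add: W'_def)
      qed (use ok(10) in \<open>auto simp: W'_def\<close>)
    qed
    then have "ok (i', k', F', Y', W')"
      using F' Y' W' i' ok(8,9) by (auto simp: ok_def F'_def W'_def)
    moreover have "step s (i', k', F', Y', W')"
      using i' by (simp add: step_def F'_def Y'_def W'_def)
    ultimately show "\<exists>t. ok t \<and> step s t" by blast
  qed
  then obtain f where f: "\<And>n. ok (f n)" and st: "\<And>n. step (f n) (f (Suc n))" by blast
  define \<mu> where "\<mu> n = fst (f n)" for n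
  define \<kappa> where "\<kappa> n = fst (snd (f n))" for n
  define F where "F n = fst (snd (snd (f n)))" for n
  define Y where "Y n = fst (snd (snd (snd (f n))))" for n
  define W where "W n = snd (snd (snd (snd (f n))))" for n
  have f_eq: "f n = (\<mu> n, \<kappa> n, F n, Y n, W n)" for n
    by (simp add: \<mu>_def \<kappa>_def F_def Y_def W_def)
  have okn: "\<mu> n < \<kappa> n \<and> finite (F n) \<and> finite (Y n) \<and> finite (W n) \<and>
      F n \<subseteq> carrier G \<and> Y n \<subseteq> carrier G \<and> W n \<subseteq> carrier G \<and> \<one> \<in> F n \<and> \<one> \<in> W n \<and>
      (\<forall>w\<in>W n. inv w \<in> W n) \<and> fresh (F n) (Y n) (\<mu> n) (\<kappa> n) \<inter> W n = {}" for n
    using f[of n] unfolding f_eq ok_def by simp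
  have stn: "\<kappa> n < \<mu> (Suc n) \<and> F (Suc n) = F n \<union> (\<lambda>a. a \<otimes> g (\<mu> n)) ` F n \<and>
      Y (Suc n) = Y n \<union> (\<lambda>a. a \<otimes> x (\<mu> n) (\<kappa> n)) ` F n \<and>
      W (Suc n) = W n \<union> fresh (F n) (Y n) (\<mu> n) (\<kappa> n) \<union> m_inv G ` fresh (F n) (Y n) (\<mu> n) (\<kappa> n)" for n
    using st[of n] unfolding f_eq step_def by simp
  have "thin_sequences G (\<lambda>n. g (\<mu> n)) (\<lambda>n. x (\<mu> n) (\<kappa> n)) F Y W"
  proof (unfold_locales)
    fix n a a' y
    show "w \<in> W n \<Longrightarrow> inv w \<in> W n" for w using okn[of n] by blast
    have new: "z \<in> W (Suc n) - W n" if "z \<in> fresh (F n) (Y n) (\<mu> n) (\<kappa> n)" for z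
      using that okn[of n] stn[of n] by blast
    show "a \<otimes> g (\<mu> n) \<otimes> inv a' \<in> W (Suc n) - W n" if "a \<in> F n" "a' \<in> F n"
      by (rule new) (use that in \<open>force simp: fresh_def\<close>)
    show "a \<otimes> x (\<mu> n) (\<kappa> n) \<otimes> inv y \<in> W (Suc n) - W n" if "a \<in> F n" "y \<in> Y n"
      by (rule new) (use that in \<open>force simp: fresh_def\<close>)
  qed (use g x okn stn in auto)
  then show thesis using that[of \<mu> \<kappa> F Y W] okn stn unfolding x_def by blast
qed

lemma IP_imp_coarse_copy:
  assumes "is_piecewise_shifted_IP_set G S"
  obtains T where "T \<subseteq> S" "coarsely_equivalent G T Z2_sum (carrier Z2_sum)"
proof -
  obtain g b where g: "\<And>n. g n \<in> carrier G" and "inj g" and b: "\<And>n. b n \<in> carrier G"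
    and S: "S = piecewise_shifted_IP_set G g b"
    using assms by (auto simp: is_piecewise_shifted_IP_set_def Pi_iff)
  obtain \<mu> \<kappa> F Y W where \<mu>\<kappa>: "\<And>n. \<mu> n < \<kappa> n" "\<And>n. \<kappa> n < \<mu> (Suc n)"
    and thin: "thin_sequences G (\<lambda>n. g (\<mu> n)) (\<lambda>n. g (\<mu> n) \<otimes> (g (\<kappa> n) \<otimes> b (\<kappa> n))) F Y W"
    by (rule thin_subsequence[OF g \<open>inj g\<close> b]) (rule that)
  interpret thin_sequences G "\<lambda>n. g (\<mu> n)" "\<lambda>n. g (\<mu> n) \<otimes> (g (\<kappa> n) \<otimes> b (\<kappa> n))" F Y W
    by (rule thin)
  have "strict_mono \<mu>"
    unfolding strict_mono_Suc_iff using \<mu>\<kappa> less_trans by blast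
  have "branch_point (\<lambda>n. g (\<mu> n)) (\<lambda>n. g (\<mu> n) \<otimes> (g (\<kappa> n) \<otimes> b (\<kappa> n))) I \<in> S" for I
  proof -
    define m where "m = Max I"
    \<comment> \<open>The new last factor consumes two old indices, \<open>\<mu> m\<close> and \<open>\<kappa> m\<close>.\<close>
    define js where "js = map \<mu> (filter (\<lambda>i. i \<in> I) [0..<m]) @ [\<mu> m, \<kappa> m]"
    have "foldr (\<lambda>i x. g i \<otimes> x) js (b (last js))
        = foldr (\<lambda>i x. g (\<mu> i) \<otimes> x) (filter (\<lambda>i. i \<in> I) [0..<m]) (g (\<mu> m) \<otimes> (g (\<kappa> m) \<otimes> b (\<kappa> m)))"
      by (simp add: js_def foldr_map comp_def)
    also have "\<dots> = branch_point (\<lambda>n. g (\<mu> n)) (\<lambda>n. g (\<mu> n) \<otimes> (g (\<kappa> n) \<otimes> b (\<kappa> n))) I"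
      unfolding branch_point_def m_def[symmetric]
      using subproduct_mult_eq_foldr[of "\<lambda>n. g (\<mu> n)" "g (\<mu> m) \<otimes> (g (\<kappa> m) \<otimes> b (\<kappa> m))" I m] g b
      by simp
    finally have eq: "branch_point (\<lambda>n. g (\<mu> n)) (\<lambda>n. g (\<mu> n) \<otimes> (g (\<kappa> n) \<otimes> b (\<kappa> n))) I
        = foldr (\<lambda>i x. g i \<otimes> x) js (b (last js))" by simp
    have "sorted_wrt (<) (map \<mu> (filter (\<lambda>i. i \<in> I) [0..<m]))"
      using \<open>strict_mono \<mu>\<close> by (simp add: sorted_wrt_map sorted_wrt_filter strict_mono_less)
    moreover have "\<mu> i < \<mu> m" "\<mu> i < \<kappa> m" if "i < m" for i
      using \<mu>\<kappa>(1)[of m] strict_monoD[OF \<open>strict_mono \<mu>\<close> that] by simp_all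
    ultimately have "sorted_wrt (<) js"
      using \<mu>\<kappa>(1)[of m] by (auto simp: js_def sorted_wrt_append)
    moreover have "js \<noteq> []" by (simp add: js_def)
    ultimately show ?thesis unfolding eq S piecewise_shifted_IP_set_def by blast
  qed
  then have "ip_point ` nonzero \<subseteq> S" unfolding ip_point_def by blast
  then show thesis using coarsely_equivalent_ip_point that by blast
qed

end

theorem theorem1:
  fixes G :: "('a, 'b) monoid_scheme" and A :: "'a set"
  assumes "group G" and "A \<subseteq> carrier G"
  shows "(scattered G A \<longleftrightarrow> disparse G A) \<and>
         (disparse G A \<longleftrightarrow>
            \<not> (\<exists>S. S \<subseteq> A \<and> coarsely_equivalent G S Z2_sum (carrier Z2_sum))) \<and>
         (\<not> (\<exists>S. S \<subseteq> A \<and> coarsely_equivalent G S Z2_sum (carrier Z2_sum)) \<longleftrightarrow>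
            \<not> (\<exists>S. S \<subseteq> A \<and> is_piecewise_shifted_IP_set G S))"
proof -
  interpret group G by fact
  have "\<not> scattered G A" if "S \<subseteq> A" "coarsely_equivalent G S Z2_sum (carrier Z2_sum)" for S
    by (rule coarse_copy_imp_not_scattered[OF group_Z2_sum infinite_Z2_sum that(2,1) assms(2)])
  moreover have "scattered G A" if "disparse G A"
    by (rule disparse_imp_scattered[OF assms(2) that])
  moreover have "\<exists>S. S \<subseteq> A \<and> is_piecewise_shifted_IP_set G S" if nd: "\<not> disparse G A"
  proof -
    obtain S where "S \<subseteq> A" "is_piecewise_shifted_IP_set G S"
      by (rule not_disparse_imp_IP[OF assms(2) nd])
    then show ?thesis by (intro exI conjI)
  qed
  moreover have "\<exists>T. T \<subseteq> A \<and> coarsely_equivalent G T Z2_sum (carrier Z2_sum)"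
    if S: "S \<subseteq> A" "is_piecewise_shifted_IP_set G S" for S
  proof -
    obtain T where "T \<subseteq> S" "coarsely_equivalent G T Z2_sum (carrier Z2_sum)"
      by (rule IP_imp_coarse_copy[OF S(2)])
    then show ?thesis using S(1) by (intro exI[of _ T] conjI subset_trans[of T S A])
  qed
  ultimately show ?thesis by metis
qed

end
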